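(* Let $p\in[2,\infty)$, $\alpha=\frac{p-2}{p+N}$ and $\beta=\frac{2+N}{p+N}$. For $\epsilon\in(0,\epsilon_0]$ let $u_\epsilon:X\to\mathbb{R}$ be the unique bounded Borel function satisfying $$u_\epsilon(x)=\begin{cases}\displaystyle \max\Big\{\Psi(x),\ \frac{\alpha}{2}\sup_{B_\epsilon(x)}u_\epsilon+\frac{\alpha}{2}\inf_{B_\epsilon(x)}u_\epsilon+\beta\,\frac{1}{|B_\epsilon(x)|}\int_{B_\epsilon(x)}u_\epsilon(y)\,dy\Big\} & \text{for } x\in\Omega,\\[2mm] F(x) & \text{for } x\in\Gamma.\end{cases}$$ Then for every $\eta>0$ there exist $r_0>0$ and $\hat\epsilon\in(0,\epsilon_0]$ such that for all $\epsilon\in(0,\hat\epsilon)$ and all $x_0,y_0\in\bar\Omega$: $$|x_0-y_0|<r_0\ \Longrightarrow\ |u_\epsilon(x_0)-u_\epsilon(y_0)|<\eta.$$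
   Context: $\Omega\subset\mathbb{R}^N$ is an open, bounded set with Lipschitz boundary. A small constant $0<\epsilon_0\ll1$ is fixed, $\Gamma=\{x\in\mathbb{R}^N\setminus\Omega:\ \mathrm{dist}(x,\Omega)<\epsilon_0\}$ and $X=\Omega\cup\Gamma$. $B_\epsilon(x)$ is the open ball of radius $\epsilon$ centered at $x$. The boundary datum $F$ on $\partial\Omega$ and the obstacle $\Psi$ are Lipschitz continuous with $\Psi\le F$ on $\partial\Omega$. They are regarded as extended to Lipschitz functions $F:\bar\Gamma\to\mathbb{R}$ and $\Psi:\mathbb{R}^N\to\mathbb{R}$ (bounded), with $\Psi\le F$ still holding on $\bar\Gamma$. *)

theory Defs
  imports "HOL-Analysis.Analysis"
begin

text \<open>
  Near each boundary point, \<open>\<Omega>\<close> lies strictly on one side of the graph of a Lipschitz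
  function. The vector \<open>e\<close> is the vertical direction of a local orthonormal coordinate system, the
  hyperplane orthogonal to \<open>e\<close> plays the role of \<open>\<real>\<^sup>N\<^sup>-\<^sup>1\<close>, and \<open>y - (e \<bullet> y) *\<^sub>R e\<close> is the
  projection of \<open>y\<close> onto it.
\<close>

definition lipschitz_boundary :: "'a::euclidean_space set \<Rightarrow> bool" where
  "lipschitz_boundary \<Omega> \<longleftrightarrow>
    (\<forall>z \<in> frontier \<Omega>. \<exists>r > 0. \<exists>e \<phi> L. norm e = 1 \<and> L-lipschitz_on {v. e \<bullet> v = 0} \<phi> \<and>
      \<Omega> \<inter> ball z r = {y \<in> ball z r. \<phi> (y - (e \<bullet> y) *\<^sub>R e) < e \<bullet> y})"

text \<open>
  The set \<open>\<Gamma>\<close>; it contains \<open>frontier \<Omega>\<close> if \<open>\<Omega>\<close> is open. For \<open>\<Omega> = {}\<close> the library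
  convention \<open>infdist x {} = 0\<close> makes it the whole space.
\<close>

definition outer_collar :: "real \<Rightarrow> 'a::euclidean_space set \<Rightarrow> 'a set" where
  "outer_collar \<epsilon>\<^sub>0 \<Omega> = {x. x \<notin> \<Omega> \<and> infdist x \<Omega> < \<epsilon>\<^sub>0}"

definition ball_average :: "real \<Rightarrow> ('a::euclidean_space \<Rightarrow> real) \<Rightarrow> 'a \<Rightarrow> real" where
  "ball_average \<epsilon> u x = 1 / measure lborel (ball x \<epsilon>) * (LINT y:ball x \<epsilon>|lborel. u y)"

text \<open>
  Bounded Borel solutions on \<open>X = \<Omega> \<union> \<Gamma>\<close> of the dynamic programming equation with obstacle
  \<open>\<Psi>\<close> and boundary values \<open>F\<close>. The values of \<open>u\<close> outside \<open>X\<close> are irrelevant when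
  \<open>\<epsilon> \<le> \<epsilon>\<^sub>0\<close>, since then \<open>ball x \<epsilon> \<subseteq> X\<close> for all \<open>x \<in> \<Omega>\<close>.
\<close>

definition obstacle_dpp_solution ::
  "real \<Rightarrow> real \<Rightarrow> real \<Rightarrow> 'a::euclidean_space set \<Rightarrow> ('a \<Rightarrow> real) \<Rightarrow> ('a \<Rightarrow> real) \<Rightarrow> real \<Rightarrow>
    ('a \<Rightarrow> real) \<Rightarrow> bool" where
  "obstacle_dpp_solution \<alpha> \<beta> \<epsilon>\<^sub>0 \<Omega> F \<Psi> \<epsilon> u \<longleftrightarrow>
    bounded (u ` (\<Omega> \<union> outer_collar \<epsilon>\<^sub>0 \<Omega>)) \<and>
    u \<in> borel_measurable (restrict_space borel (\<Omega> \<union> outer_collar \<epsilon>\<^sub>0 \<Omega>)) \<and>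
    (\<forall>x \<in> \<Omega>. u x = max (\<Psi> x)
      (\<alpha> / 2 * (SUP y\<in>ball x \<epsilon>. u y) + \<alpha> / 2 * (INF y\<in>ball x \<epsilon>. u y) + \<beta> * ball_average \<epsilon> u x)) \<and>
    (\<forall>x \<in> outer_collar \<epsilon>\<^sub>0 \<Omega>. u x = F x)"

end

theory Submission
  imports Defs
begin

text \<open>
  The modulus of continuity is first established at the boundary and then carried into the interior
  by translation, since the dynamic programming equation is invariant under translations.

  At the boundary, solutions are compared with explicit barriers. The functions
  \<open>a - b * exp (- \<sigma> * (dist y z)\<^sup>2)\<close> increase with the distance from \<open>z\<close> and are, for large \<open>\<sigma>\<close>
  and away from \<open>z\<close>, strict supersolutions for every small step size \<open>\<epsilon>\<close>
  (\<open>game_mean_gaussian_le\<close>). No Taylor expansion is needed, because the Gaussian factorises exactly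
  around each point and both the tug-of-war part and the averaging part reduce to the inequality
  \<open>2 + t\<^sup>2 \<le> exp t + exp (- t)\<close>. Strict supersolutions lie above subsolutions by an immediate
  supremum argument (\<open>gaussian_barrier_comparison\<close>).

  A Lipschitz domain has, at each boundary point \<open>z\<close> and each small scale \<open>t\<close>, an exterior ball of
  radius \<open>\<mu> * t\<close> within distance of order \<open>t\<close> (\<open>lipschitz_boundary_corkscrew\<close>). A barrier centred
  there shows that, if a subsolution exceeds the boundary data near \<open>z\<close> by at most \<open>M\<close>, then it exceeds
  them by at most \<open>\<theta> * M\<close> on a ball five times smaller, with a fixed \<open>\<theta> < 1\<close>
  (\<open>boundary_oscillation_decay\<close>). A fixed number of iterations makes this excess small; applied to
  \<open>u\<close> and to \<open>- u\<close>, it gives a modulus of continuity at the boundary that does not depend on \<open>\<epsilon>\<close>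
  or on the boundary point. A uniform bound for the solutions, needed to start the iteration, comes
  from a barrier centred far from the domain.

  In the interior, \<open>u\<close> and its translate \<open>u (x + h) + \<eta>\<close> solve the same equation on the set of all
  \<open>x\<close> with \<open>x \<in> \<Omega>\<close> and \<open>x + h \<in> \<Omega>\<close>, for obstacles that are ordered if \<open>h\<close> is small. Where a step
  leaves this set, \<open>x\<close> or \<open>x + h\<close> lies in the collar while the other is close to the boundary or in
  the collar as well, and there the values are ordered by the modulus at the boundary. The
  comparison principle (\<open>translation_comparison\<close>) gives the order everywhere.
\<close>

section \<open>Averages over balls\<close>

definition bounded_borel_on :: "'a::euclidean_space set \<Rightarrow> ('a \<Rightarrow> real) \<Rightarrow> bool" where
  "bounded_borel_on S u \<longleftrightarrow> bounded (u ` S) \<and> u \<in> borel_measurable (restrict_space borel S)"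

text \<open>
  The right-hand side of the dynamic programming equation without the obstacle, that is, the mean
  value operator of the tug-of-war game with noise.
\<close>

definition game_mean :: "real \<Rightarrow> real \<Rightarrow> real \<Rightarrow> ('a::euclidean_space \<Rightarrow> real) \<Rightarrow> 'a \<Rightarrow> real" where
  "game_mean \<alpha> \<beta> \<epsilon> u x =
     \<alpha> / 2 * (SUP y\<in>ball x \<epsilon>. u y) + \<alpha> / 2 * (INF y\<in>ball x \<epsilon>. u y) + \<beta> * ball_average \<epsilon> u x"

lemma bounded_borel_on_subset:
  assumes "bounded_borel_on S u" "T \<subseteq> S"
  shows "bounded_borel_on T u"
  using assms measurable_restrict_mono[of u borel S borel T]
  unfolding bounded_borel_on_def by (meson bounded_subset image_mono)

lemma bounded_borel_on_ball_continuous: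
  assumes "continuous_on (cball x \<epsilon>) u"
  shows "bounded_borel_on (ball x \<epsilon>) u"
proof (rule bounded_borel_on_subset)
  have "bounded (u ` cball x \<epsilon>)"
    using assms by (intro compact_imp_bounded compact_continuous_image) auto
  then show "bounded_borel_on (cball x \<epsilon>) u"
    using assms unfolding bounded_borel_on_def
    by (auto intro: borel_measurable_continuous_on_restrict)
qed auto

lemma bounded_borel_on_ball_integrable:
  assumes "bounded_borel_on (ball x \<epsilon>) u"
  shows "set_integrable lborel (ball x \<epsilon>) u"
proof -
  obtain B where B: "\<And>y. y \<in> ball x \<epsilon> \<Longrightarrow> norm (u y) \<le> B"
    using assms unfolding bounded_borel_on_def bounded_iff by blast
  have "set_integrable lborel (ball x \<epsilon>) (\<lambda>_. \<bar>B\<bar>)"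
    using emeasure_lborel_ball_finite[of x \<epsilon>]
    by (auto simp: set_integrable_def intro!: integrable_mult_left integrable_real_indicator)
  moreover have "set_borel_measurable lborel (ball x \<epsilon>) u"
    using assms borel_measurable_restrict_space_iff[of "ball x \<epsilon>" borel u]
    unfolding bounded_borel_on_def set_borel_measurable_def by simp
  ultimately show ?thesis
  proof (rule set_integrable_bound)
    show "AE y in lborel. y \<in> ball x \<epsilon> \<longrightarrow> norm (u y) \<le> norm \<bar>B\<bar>"
      using B by (auto intro!: AE_I2 order_trans[OF _ abs_ge_self])
  qed
qed

lemma ball_average_mono:
  assumes "set_integrable lborel (ball x \<epsilon>) u" "set_integrable lborel (ball x \<epsilon>) v"
    and "\<And>y. y \<in> ball x \<epsilon> \<Longrightarrow> u y \<le> v y"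
  shows "ball_average \<epsilon> u x \<le> ball_average \<epsilon> v x"
  unfolding ball_average_def using assms
  by (intro mult_left_mono set_integral_mono) auto

lemma ball_average_const: "0 < \<epsilon> \<Longrightarrow> ball_average \<epsilon> (\<lambda>_. c) x = c"
  using emeasure_lborel_ball_finite[of x \<epsilon>] content_ball_pos[of \<epsilon> x]
  unfolding ball_average_def by (subst set_integral_const) auto

lemma ball_average_add:
  assumes "set_integrable lborel (ball x \<epsilon>) u" "set_integrable lborel (ball x \<epsilon>) v"
  shows "ball_average \<epsilon> (\<lambda>y. u y + v y) x = ball_average \<epsilon> u x + ball_average \<epsilon> v x"
  using assms unfolding ball_average_def by (simp add: add_divide_distrib)

lemma ball_average_mult: "ball_average \<epsilon> (\<lambda>y. c * u y) x = c * ball_average \<epsilon> u x"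
  unfolding ball_average_def by simp

lemma lborel_integral_isometry:
  fixes f :: "'a::euclidean_space \<Rightarrow> real"
  assumes "\<bar>s\<bar> = 1" and [measurable]: "f \<in> borel_measurable borel"
  shows "(\<integral>y. f (t + s *\<^sub>R y) \<partial>lborel) = (\<integral>y. f y \<partial>lborel)"
proof -
  have "lborel = distr lborel borel (\<lambda>y::'a. t + s *\<^sub>R y)"
    using assms(1) by (subst lborel_affine[of s t]) (auto simp: density_1)
  then have "(\<integral>y. f y \<partial>lborel) = (\<integral>y. f y \<partial>distr lborel borel (\<lambda>y::'a. t + s *\<^sub>R y))"
    by simp
  also have "\<dots> = (\<integral>y. f (t + s *\<^sub>R y) \<partial>lborel)"
    by (rule integral_distr) measurable
  finally show ?thesis by simp
qed

text \<open>
  With \<open>s = 1\<close> this is translation, with \<open>s = -1\<close> and \<open>t = 2 *\<^sub>R x\<close> the point reflection in the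
  centre \<open>x\<close> of the ball.
\<close>

lemma ball_average_isometry:
  fixes u :: "'a::euclidean_space \<Rightarrow> real"
  assumes s: "\<bar>s\<bar> = 1" and \<epsilon>: "0 < \<epsilon>"
    and u: "bounded_borel_on (ball (t + s *\<^sub>R x) \<epsilon>) u"
  shows "ball_average \<epsilon> (\<lambda>y. u (t + s *\<^sub>R y)) x = ball_average \<epsilon> u (t + s *\<^sub>R x)"
proof -
  let ?B = "ball (t + s *\<^sub>R x) \<epsilon>"
  have meas: "(\<lambda>y. indicator ?B y *\<^sub>R u y) \<in> borel_measurable borel"
    using u borel_measurable_restrict_space_iff[of ?B borel u] unfolding bounded_borel_on_def by simp
  have mem: "t + s *\<^sub>R y \<in> ?B \<longleftrightarrow> y \<in> ball x \<epsilon>" for y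
  proof -
    have "dist (t + s *\<^sub>R x) (t + s *\<^sub>R y) = dist x y"
      using s by (simp add: dist_norm flip: scaleR_diff_right)
    then show ?thesis by simp
  qed
  have "(LINT y:ball x \<epsilon>|lborel. u (t + s *\<^sub>R y))
      = (\<integral>y. indicator ?B (t + s *\<^sub>R y) *\<^sub>R u (t + s *\<^sub>R y) \<partial>lborel)"
    unfolding set_lebesgue_integral_def
    by (intro Bochner_Integration.integral_cong) (auto simp: indicator_def mem simp del: mem_ball)
  also have "\<dots> = (LINT y:?B|lborel. u y)"
    unfolding set_lebesgue_integral_def by (rule lborel_integral_isometry[OF s meas])
  finally show ?thesis
    unfolding ball_average_def
    using \<epsilon> by (simp add: content_ball)
qed

text \<open>
  A lower bound for half the second moment of a linear functional \<open>a \<bullet> d\<close> over the unit ball,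
  relative to \<open>(norm a)\<^sup>2\<close>: on the ball of radius \<open>1 / 4\<close> around \<open>a / (2 * norm a)\<close>, which carries the
  fraction \<open>1 / 4 ^ DIM('a)\<close> of the volume, the functional is at least \<open>norm a / 4\<close>. The sharp value
  is \<open>1 / (2 * (DIM('a) + 2))\<close>; a larger value would improve only the constants below.
\<close>

definition moment_const :: "'a::euclidean_space itself \<Rightarrow> real" where
  "moment_const _ = 1 / (32 * 4 ^ DIM('a))"

lemma moment_const_bounds: "0 < moment_const TYPE('a::euclidean_space)" "moment_const TYPE('a) \<le> 1 / 2"
proof -
  have "(1::real) \<le> 4 ^ DIM('a)" by simp
  then have "(1::real) \<le> 16 * 4 ^ DIM('a)" by linarith
  then show "0 < moment_const TYPE('a)" "moment_const TYPE('a) \<le> 1 / 2"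
    unfolding moment_const_def by (simp_all add: divide_simps)
qed

lemma cosh_quadratic: "2 + t\<^sup>2 \<le> exp t + exp (- t)" for t :: real
proof -
  have *: "s \<le> sinh s" if "0 \<le> s" for s :: real
  proof -
    have "sinh 0 - 0 \<le> sinh s - s"
      by (rule DERIV_nonneg_imp_nondecreasing[OF that])
        (auto intro!: exI derivative_eq_intros simp: cosh_real_ge_1)
    then show ?thesis by simp
  qed
  have "(t/2)\<^sup>2 \<le> (sinh (t/2))\<^sup>2"
  proof (cases "0 \<le> t")
    case True
    then show ?thesis using *[of "t/2"] by (intro power_mono) auto
  next
    case False
    then show ?thesis using *[of "-t/2"]
      using power_mono[of "-t/2" "sinh (-t/2)" 2] by (simp add: sinh_minus)
  qed
  moreover have "cosh t = 1 + 2 * (sinh (t/2))\<^sup>2"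
    using cosh_double[of "t/2"] cosh_square_eq[of "t/2"] by simp
  ultimately show ?thesis by (simp add: cosh_def field_simps power2_eq_square)
qed

text \<open>
  This convexity estimate is the one place where the averaging part of the game is computed. Pairing
  each point of the ball with its reflection in the centre replaces the exponential by a hyperbolic
  cosine, which exceeds \<open>1\<close> by at least half the square of its argument; that square is then bounded below
  on the smaller ball described at \<^const>\<open>moment_const\<close>.
\<close>

lemma ball_average_exp_ge:
  fixes a :: "'a::euclidean_space"
  assumes \<epsilon>: "0 < \<epsilon>"
  shows "1 + moment_const TYPE('a) * (norm a * \<epsilon>)\<^sup>2 \<le> ball_average \<epsilon> (\<lambda>y. exp (a \<bullet> (y - x))) x"
proof (cases "a = 0")
  case True
  then show ?thesis by (simp add: ball_average_const[OF \<epsilon>])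
next
  case False
  define K where "K = ball (x + (\<epsilon> / (2 * norm a)) *\<^sub>R a) (\<epsilon> / 4)"
  let ?E = "\<lambda>y. exp (a \<bullet> (y - x))" and ?E' = "\<lambda>y. exp (a \<bullet> (x - y))"
  let ?k = "(norm a * \<epsilon> / 4)\<^sup>2"
  have na: "norm a > 0" using False by simp
  have bb: "bounded_borel_on (ball x \<epsilon>) (\<lambda>y. exp (b \<bullet> (y - x)))" for b :: 'a
    by (intro bounded_borel_on_ball_continuous continuous_intros)
  have int: "set_integrable lborel (ball x \<epsilon>) ?E" "set_integrable lborel (ball x \<epsilon>) ?E'"
    using bounded_borel_on_ball_integrable[OF bb[of a]] bounded_borel_on_ball_integrable[OF bb[of "-a"]]
    by (simp_all add: inner_diff_right)
  have refl: "ball_average \<epsilon> ?E' x = ball_average \<epsilon> ?E x"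
    using ball_average_isometry[of "-1" \<epsilon> "2 *\<^sub>R x" x ?E] \<epsilon> bb[of a]
    by (simp add: scaleR_2 algebra_simps)
  have dK: "dist x (x + (\<epsilon> / (2 * norm a)) *\<^sub>R a) = \<epsilon> / 2"
    using na \<epsilon> by (simp add: dist_norm)
  have KB: "K \<subseteq> ball x \<epsilon>"
  proof
    fix y assume "y \<in> K"
    then show "y \<in> ball x \<epsilon>"
      using dist_triangle[of x y "x + (\<epsilon> / (2 * norm a)) *\<^sub>R a"] dK \<epsilon> unfolding K_def by auto
  qed
  have sK: "norm a * \<epsilon> / 4 \<le> a \<bullet> (y - x)" if "y \<in> K" for y
  proof -
    define d where "d = y - (x + (\<epsilon> / (2 * norm a)) *\<^sub>R a)"
    have "norm d \<le> \<epsilon> / 4" using that unfolding K_def d_def by (simp add: dist_norm norm_minus_commute)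
    then have "\<bar>a \<bullet> d\<bar> \<le> norm a * (\<epsilon> / 4)"
      using Cauchy_Schwarz_ineq2[of a d] na by (meson mult_left_mono norm_ge_zero order_trans)
    moreover have "a \<bullet> (y - x) = a \<bullet> d + norm a * \<epsilon> / 2"
      unfolding d_def using na
      by (simp add: inner_diff_right inner_add_right field_simps dot_square_norm power2_eq_square)
    ultimately show ?thesis by linarith
  qed
  have int1: "set_integrable lborel (ball x \<epsilon>) (\<lambda>_. 2 :: real)"
    using emeasure_lborel_ball_finite[of x \<epsilon>]
    by (auto simp: set_integrable_def intro!: integrable_mult_left integrable_real_indicator)
  have emK: "emeasure lborel (ball x \<epsilon> \<inter> K) < \<infinity>" using KB emeasure_lborel_ball_finite[of x \<epsilon>]
    by (meson emeasure_mono inf_le1 lborelD le_less_trans open_ball borel_open sets_lborel)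
  have int2: "set_integrable lborel (ball x \<epsilon>) (indicator K :: 'a \<Rightarrow> real)"
    using emK unfolding set_integrable_def
    by (auto simp: K_def simp flip: indicator_inter_arith intro!: integrable_real_indicator)
  have avK: "ball_average \<epsilon> (indicator K) x = 1 / 4 ^ DIM('a)"
  proof -
    have "(LINT y:ball x \<epsilon>|lborel. indicator K y) = measure lborel (ball x \<epsilon> \<inter> K)"
      unfolding set_lebesgue_integral_def by (simp flip: indicator_inter_arith)
    also have "ball x \<epsilon> \<inter> K = K" using KB by auto
    finally show ?thesis
      using \<epsilon> content_ball_pos[OF \<epsilon>, of x] unfolding ball_average_def K_def
      by (simp add: content_ball power_divide less_imp_neq[OF unit_ball_vol_pos, symmetric])
  qed
  have "2 + ?k / 4 ^ DIM('a) = ball_average \<epsilon> (\<lambda>y. 2 + ?k * indicator K y) x"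
    using int1 int2 by (subst ball_average_add) (auto simp: ball_average_mult avK ball_average_const[OF \<epsilon>])
  also have "\<dots> \<le> ball_average \<epsilon> (\<lambda>y. ?E y + ?E' y) x"
  proof (rule ball_average_mono)
    fix y
    have "?k * indicator K y \<le> (a \<bullet> (y - x))\<^sup>2"
      using sK[of y] na \<epsilon> power_mono[of "norm a * \<epsilon> / 4" "a \<bullet> (y - x)" 2] by (auto simp: indicator_def)
    then show "2 + ?k * indicator K y \<le> ?E y + ?E' y"
      using cosh_quadratic[of "a \<bullet> (y - x)"] by (simp add: inner_diff_right)
  qed (use int int1 int2 in auto)
  also have "\<dots> = 2 * ball_average \<epsilon> ?E x" using int by (simp add: ball_average_add refl)
  finally show ?thesis by (simp add: moment_const_def power_divide field_simps)
qed

section \<open>The mean value operator and its Gaussian barriers\<close>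

lemma bounded_borel_on_bdd:
  assumes "bounded_borel_on S u"
  shows "bdd_above (u ` S)" "bdd_below (u ` S)"
  using assms bounded_imp_bdd_above bounded_imp_bdd_below unfolding bounded_borel_on_def by auto

lemma bounded_borel_on_uminus:
  assumes "bounded_borel_on S u"
  shows "bounded_borel_on S (\<lambda>y. - u y)"
  using assms unfolding bounded_borel_on_def
  by (auto simp: bounded_iff)

lemma game_mean_uminus:
  assumes \<epsilon>: "0 < \<epsilon>" and u: "bounded_borel_on (ball x \<epsilon>) u"
  shows "game_mean \<alpha> \<beta> \<epsilon> (\<lambda>y. - u y) x = - game_mean \<alpha> \<beta> \<epsilon> u x"
proof -
  have ne: "ball x \<epsilon> \<noteq> {}" using \<epsilon> by simp
  have "(SUP y\<in>ball x \<epsilon>. - u y) = - (INF y\<in>ball x \<epsilon>. u y)"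
    using uminus_cINF[OF bounded_borel_on_bdd(2)[OF u] ne] by simp
  moreover have "(INF y\<in>ball x \<epsilon>. - u y) = - (SUP y\<in>ball x \<epsilon>. u y)"
    using uminus_cSUP[OF bounded_borel_on_bdd(1)[OF u] ne] by simp
  moreover have "ball_average \<epsilon> (\<lambda>y. - u y) x = - ball_average \<epsilon> u x"
    using ball_average_mult[of \<epsilon> "-1" u x] by simp
  ultimately show ?thesis unfolding game_mean_def by (simp add: algebra_simps)
qed

text \<open>
  Monotonicity of the mean value operator for functions at two different centres. The nonnegative
  gap \<open>g\<close> is lost in the supremum and the infimum but is recorded by the average; this is how the
  averaging part turns a weak inequality into a strict one in the comparison of translates.
\<close>

lemma game_mean_translate_le:
  assumes \<alpha>\<beta>: "0 \<le> \<alpha>" "0 \<le> \<beta>" "\<alpha> + \<beta> = 1" and \<epsilon>: "0 < \<epsilon>"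
    and u: "bounded_borel_on (ball x \<epsilon>) u" and v: "bounded_borel_on (ball (x + h) \<epsilon>) v"
    and g: "set_integrable lborel (ball x \<epsilon>) g" "\<And>y. y \<in> ball x \<epsilon> \<Longrightarrow> 0 \<le> g y"
    and le: "\<And>y. y \<in> ball x \<epsilon> \<Longrightarrow> u y + g y \<le> v (y + h) + S"
  shows "game_mean \<alpha> \<beta> \<epsilon> u x + \<beta> * ball_average \<epsilon> g x \<le> game_mean \<alpha> \<beta> \<epsilon> v (x + h) + S"
proof -
  let ?B = "ball x \<epsilon>" and ?B' = "ball (x + h) \<epsilon>"
  have ne: "?B \<noteq> {}" "?B' \<noteq> {}" using \<epsilon> by simp_all
  have mem: "y + h \<in> ?B' \<longleftrightarrow> y \<in> ?B" for y by (simp add: dist_norm)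
  have le': "u y \<le> v (y + h) + S" if "y \<in> ?B" for y using le[OF that] g(2)[OF that] by linarith
  have sup: "(SUP y\<in>?B. u y) \<le> (SUP y\<in>?B'. v y) + S"
  proof (rule cSUP_least[OF ne(1)])
    fix y assume y: "y \<in> ?B"
    have "v (y + h) \<le> (SUP y\<in>?B'. v y)"
      using y mem[of y] by (intro cSUP_upper bounded_borel_on_bdd[OF v]) simp
    then show "u y \<le> (SUP y\<in>?B'. v y) + S" using le'[OF y] by linarith
  qed
  have "(INF y\<in>?B. u y) - S \<le> (INF y\<in>?B'. v y)"
  proof (rule cINF_greatest[OF ne(2)])
    fix z assume "z \<in> ?B'"
    then have z: "z - h \<in> ?B" using mem[of "z - h"] by simp
    have "(INF y\<in>?B. u y) \<le> u (z - h)" by (intro cINF_lower bounded_borel_on_bdd[OF u] z)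
    then show "(INF y\<in>?B. u y) - S \<le> v z" using le'[OF z] by simp
  qed
  then have "(SUP y\<in>?B. u y) + (INF y\<in>?B. u y) \<le> (SUP y\<in>?B'. v y) + (INF y\<in>?B'. v y) + 2 * S"
    using sup by linarith
  then have "\<alpha> / 2 * ((SUP y\<in>?B. u y) + (INF y\<in>?B. u y))
      \<le> \<alpha> / 2 * ((SUP y\<in>?B'. v y) + (INF y\<in>?B'. v y) + 2 * S)"
    by (rule mult_left_mono) (use \<alpha>\<beta> in simp)
  moreover have "ball_average \<epsilon> u x + ball_average \<epsilon> g x \<le> ball_average \<epsilon> v (x + h) + S"
  proof -
    have iu: "set_integrable lborel ?B u" by (rule bounded_borel_on_ball_integrable[OF u])
    have hx: "h + 1 *\<^sub>R x = x + h" by simp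
    have bv: "bounded_borel_on ?B (\<lambda>y. v (h + 1 *\<^sub>R y))"
      unfolding bounded_borel_on_def
    proof
      have "(\<lambda>y. v (h + 1 *\<^sub>R y)) ` ?B \<subseteq> v ` ?B'" using mem by (auto simp: add.commute)
      then show "bounded ((\<lambda>y. v (h + 1 *\<^sub>R y)) ` ?B)"
        using v bounded_subset unfolding bounded_borel_on_def by blast
      have "(\<lambda>y. h + 1 *\<^sub>R y) \<in> measurable (restrict_space borel ?B) (restrict_space borel ?B')"
        using mem by (intro measurable_restrict_space3) (auto simp: add.commute)
      then show "(\<lambda>y. v (h + 1 *\<^sub>R y)) \<in> borel_measurable (restrict_space borel ?B)"
        using v measurable_compose unfolding bounded_borel_on_def by blast
    qed
    have iv: "set_integrable lborel ?B (\<lambda>y. v (h + 1 *\<^sub>R y))"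
      by (rule bounded_borel_on_ball_integrable[OF bv])
    have iS: "set_integrable lborel ?B (\<lambda>_. S)"
      by (rule bounded_borel_on_ball_integrable) (auto simp: bounded_borel_on_def bounded_iff)
    have "ball_average \<epsilon> u x + ball_average \<epsilon> g x = ball_average \<epsilon> (\<lambda>y. u y + g y) x"
      by (simp only: ball_average_add[OF iu g(1)])
    also have "\<dots> \<le> ball_average \<epsilon> (\<lambda>y. v (h + 1 *\<^sub>R y) + S) x"
      using le by (intro ball_average_mono set_integral_add iu iv iS g) (auto simp: add.commute)
    also have "\<dots> = ball_average \<epsilon> (\<lambda>y. v (h + 1 *\<^sub>R y)) x + S"
      by (simp only: ball_average_add[OF iv iS] ball_average_const[OF \<epsilon>])
    also have "ball_average \<epsilon> (\<lambda>y. v (h + 1 *\<^sub>R y)) x = ball_average \<epsilon> v (h + 1 *\<^sub>R x)"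
      using v by (intro ball_average_isometry \<epsilon>) (auto simp: add.commute)
    finally show ?thesis by (simp add: add.commute)
  qed
  then have "\<beta> * (ball_average \<epsilon> u x + ball_average \<epsilon> g x) \<le> \<beta> * (ball_average \<epsilon> v (x + h) + S)"
    by (rule mult_left_mono) (use \<alpha>\<beta> in simp)
  moreover have "\<alpha> / 2 * (2 * S) + \<beta> * S = S"
    using \<alpha>\<beta>(3) by (simp flip: distrib_right)
  ultimately show ?thesis unfolding game_mean_def by (simp only: distrib_left)
qed

text \<open>
  In the barrier computation \<open>s\<close> is the loss caused by the spherical Gaussian decay over one step
  and \<open>q\<close> the gain from convexity in the radial direction: the gain wins if \<open>q\<close> is at least four
  times \<open>s\<close>.
\<close>

lemma exp_decay_growth:
  fixes s q :: real
  assumes "0 \<le> s" "s \<le> 1 / 2" "4 * s \<le> q"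
  shows "1 + s \<le> exp (- s) * (1 + q)"
proof -
  have "s * (1 - 2 * s) \<ge> 0" using assms by simp
  then have "1 + s \<le> (1 - s) * (1 + 4 * s)" by (simp add: algebra_simps)
  also have "\<dots> \<le> exp (- s) * (1 + q)"
    using assms exp_ge_add_one_self[of "-s"] by (intro mult_mono) auto
  finally show ?thesis .
qed

text \<open>
  Reversed Gaussians \<open>a - b * exp (- \<sigma> * (dist y z)\<^sup>2)\<close> are strict supersolutions away from their
  centre \<open>z\<close>. Both parts of the operator lead to the same kind of expression, since the Gaussian
  factorises: for \<open>y = x + d\<close> it equals its value at \<open>x\<close> times \<open>exp (- \<sigma> * (norm d)\<^sup>2)\<close> times the
  exponential of a linear function of \<open>d\<close>. The supremum and the infimum are bounded by the values at
  the two radial points of the sphere, where the linear factors add up to a hyperbolic cosine; for the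
  average, \<open>ball_average_exp_ge\<close> applies. In both cases the gain is of order
  \<open>(\<sigma> * dist x z * \<epsilon>)\<^sup>2\<close> and the loss of order \<open>\<sigma> * \<epsilon>\<^sup>2\<close>, so that the gain dominates as soon as
  \<open>\<sigma> * (dist x z)\<^sup>2\<close> is large.
\<close>

lemma game_mean_gaussian_le:
  fixes w :: "'a::euclidean_space \<Rightarrow> real"
  assumes \<alpha>\<beta>: "0 \<le> \<alpha>" "0 \<le> \<beta>" "\<alpha> + \<beta> = 1" and \<epsilon>: "0 < \<epsilon>" and \<sigma>: "0 < \<sigma>"
    and \<sigma>\<epsilon>: "\<sigma> * \<epsilon>\<^sup>2 \<le> 1 / 2" and \<sigma>\<rho>: "1 \<le> moment_const TYPE('a) * \<sigma> * (dist x z)\<^sup>2" and b: "0 \<le> b"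
    and w: "bounded_borel_on (ball x \<epsilon>) w"
    and le: "\<And>y. y \<in> ball x \<epsilon> \<Longrightarrow> w y \<le> a - b * exp (- \<sigma> * (dist y z)\<^sup>2)"
  shows "game_mean \<alpha> \<beta> \<epsilon> w x \<le> a - b * (exp (- \<sigma> * (dist x z)\<^sup>2) * (1 + \<sigma> * \<epsilon>\<^sup>2))"
proof -
  let ?B = "ball x \<epsilon>"
  define t where "t = dist x z"
  define E where "E = exp (- \<sigma> * t\<^sup>2)"
  define s where "s = \<sigma> * \<epsilon>\<^sup>2"
  let ?V = "\<lambda>r. a - b * exp (- \<sigma> * r\<^sup>2)"
  have t0: "0 < t"
  proof -
    have "t \<noteq> 0" using \<sigma>\<rho> unfolding t_def by auto
    then show ?thesis unfolding t_def by simp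
  qed
  have s0: "0 \<le> s" "s \<le> 1/2" using \<sigma> \<sigma>\<epsilon> unfolding s_def by auto
  have bE: "0 \<le> b * E" using b unfolding E_def by simp
  have ne: "?B \<noteq> {}" using \<epsilon> by simp
  have V_mono: "?V r \<le> ?V r'" if "0 \<le> r" "r \<le> r'" for r r'
    using that b \<sigma> power_mono[of r r' 2] by (auto intro!: mult_left_mono)
  have sup: "(SUP y\<in>?B. w y) \<le> ?V (t + \<epsilon>)"
  proof (rule cSUP_least[OF ne])
    fix y assume y: "y \<in> ?B"
    have "dist y z \<le> t + \<epsilon>"
      using dist_triangle[of y z x] y unfolding t_def by (simp add: dist_commute)
    then show "w y \<le> ?V (t + \<epsilon>)" using le[OF y] V_mono[of "dist y z" "t + \<epsilon>"] by simp
  qed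
  \<comment> \<open>Moving from x by r in the direction of z stays in the open ball and leads to a point at distance
    |t - r| from z, also if z is passed.\<close>
  have inf_r: "(INF y\<in>?B. w y) \<le> ?V (t - r)" if r: "0 < r" "r < \<epsilon>" for r
  proof -
    define y where "y = x - (r / t) *\<^sub>R (x - z)"
    have y: "y \<in> ?B" using r t0 unfolding y_def t_def by (simp add: dist_norm)
    have "y - z = (1 - r / t) *\<^sub>R (x - z)" unfolding y_def by (simp add: algebra_simps)
    then have "dist y z = \<bar>1 - r / t\<bar> * t" unfolding t_def by (simp add: dist_norm)
    also have "\<dots> = \<bar>(1 - r / t) * t\<bar>" using t0 by (simp add: abs_mult)
    also have "\<dots> = \<bar>t - r\<bar>" using t0 by (simp add: left_diff_distrib)
    finally have "(dist y z)\<^sup>2 = (t - r)\<^sup>2" by simp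
    then have "w y \<le> ?V (t - r)" using le[OF y] by simp
    moreover have "(INF y\<in>?B. w y) \<le> w y" by (intro cINF_lower bounded_borel_on_bdd[OF w] y)
    ultimately show ?thesis by linarith
  qed
  have inf: "(INF y\<in>?B. w y) \<le> ?V (t - \<epsilon>)"
  proof (rule tendsto_lowerbound)
    show "((\<lambda>r. ?V (t - r)) \<longlongrightarrow> ?V (t - \<epsilon>)) (at_left \<epsilon>)" by (intro tendsto_intros)
    show "\<forall>\<^sub>F r in at_left \<epsilon>. (INF y\<in>?B. w y) \<le> ?V (t - r)"
      by (rule eventually_mono[OF eventually_at_left_real[OF \<epsilon>]]) (rule inf_r; simp)
  qed simp
  have Vplus: "exp (- \<sigma> * (t + \<epsilon>)\<^sup>2) = E * exp (- s) * exp (- (2 * \<sigma> * t * \<epsilon>))"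
    and Vminus: "exp (- \<sigma> * (t - \<epsilon>)\<^sup>2) = E * exp (- s) * exp (2 * \<sigma> * t * \<epsilon>)"
    unfolding E_def s_def by (simp_all add: algebra_simps power2_eq_square flip: exp_add)
  have q: "4 * s \<le> 4 * k * (\<sigma> * t * \<epsilon>)\<^sup>2" if "moment_const TYPE('a) \<le> k" for k
  proof -
    have "1 \<le> moment_const TYPE('a) * (\<sigma> * t\<^sup>2)"
      using \<sigma>\<rho> unfolding t_def by (simp only: mult.assoc)
    also have "\<dots> \<le> k * (\<sigma> * t\<^sup>2)"
      by (rule mult_right_mono[OF that]) (use \<sigma> in simp)
    finally have "1 \<le> k * (\<sigma> * t\<^sup>2)" .
    then have "4 * s * 1 \<le> 4 * s * (k * (\<sigma> * t\<^sup>2))" using s0 by (intro mult_left_mono) auto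
    then show ?thesis unfolding s_def by (simp add: power2_eq_square algebra_simps)
  qed
  have "(SUP y\<in>?B. w y) + (INF y\<in>?B. w y) \<le> ?V (t + \<epsilon>) + ?V (t - \<epsilon>)"
    using sup inf by linarith
  also have "\<dots> = 2 * a - b * E * (exp (- s) * (exp (2 * \<sigma> * t * \<epsilon>) + exp (- (2 * \<sigma> * t * \<epsilon>))))"
    unfolding Vplus Vminus by (simp add: algebra_simps)
  also have "\<dots> \<le> 2 * a - b * E * (2 * (1 + s))"
  proof -
    have "2 * (1 + s) \<le> 2 * (exp (- s) * (1 + 4 * (1/2) * (\<sigma> * t * \<epsilon>)\<^sup>2))"
      using exp_decay_growth[OF s0 q[OF moment_const_bounds(2)]] by simp
    also have "\<dots> = exp (- s) * (2 + (2 * \<sigma> * t * \<epsilon>)\<^sup>2)" by (simp add: power2_eq_square algebra_simps)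
    also have "\<dots> \<le> exp (- s) * (exp (2 * \<sigma> * t * \<epsilon>) + exp (- (2 * \<sigma> * t * \<epsilon>)))"
      using cosh_quadratic by (intro mult_left_mono) auto
    finally show ?thesis using bE by (intro diff_left_mono mult_left_mono) auto
  qed
  finally have 1: "(SUP y\<in>?B. w y) + (INF y\<in>?B. w y) \<le> 2 * (a - b * (E * (1 + s)))"
    by (simp add: algebra_simps)
  have 2: "ball_average \<epsilon> w x \<le> a - b * (E * (1 + s))"
  proof -
    let ?G = "\<lambda>y. exp ((- 2 * \<sigma>) *\<^sub>R (x - z) \<bullet> (y - x))"
    define k where "k = b * (E * exp (- s))"
    have k0: "0 \<le> k" using b unfolding k_def E_def by simp
    have iw: "set_integrable lborel ?B w" by (rule bounded_borel_on_ball_integrable[OF w])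
    have iG: "set_integrable lborel ?B ?G"
      by (intro bounded_borel_on_ball_integrable bounded_borel_on_ball_continuous continuous_intros)
    have ia: "set_integrable lborel ?B (\<lambda>_. a)"
      by (rule bounded_borel_on_ball_integrable) (auto simp: bounded_borel_on_def bounded_iff)
    have ikG: "set_integrable lborel ?B (\<lambda>y. - k * ?G y)" using iG by (intro set_integrable_mult_right)
    have "ball_average \<epsilon> w x \<le> ball_average \<epsilon> (\<lambda>y. a + - k * ?G y) x"
    proof (rule ball_average_mono[OF iw set_integral_add(1)[OF ia ikG]])
      fix y assume y: "y \<in> ?B"
      have "(norm (y - x))\<^sup>2 \<le> \<epsilon>\<^sup>2"
        using y by (intro power_mono) (auto simp: dist_norm norm_minus_commute)
      then have ys: "\<sigma> * (norm (y - x))\<^sup>2 \<le> s"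
        using \<sigma> unfolding s_def by (intro mult_left_mono) auto
      have "(dist y z)\<^sup>2 = (norm ((y - x) + (x - z)))\<^sup>2" by (simp add: dist_norm)
      also have "\<dots> = (norm (y - x))\<^sup>2 + 2 * ((x - z) \<bullet> (y - x)) + t\<^sup>2"
        unfolding power2_norm_eq_inner t_def dist_norm
        by (simp add: inner_diff_left inner_diff_right inner_commute algebra_simps)
      finally have d2: "(dist y z)\<^sup>2 = (norm (y - x))\<^sup>2 + 2 * ((x - z) \<bullet> (y - x)) + t\<^sup>2" .
      have "- \<sigma> * (dist y z)\<^sup>2
          = - \<sigma> * t\<^sup>2 + - (\<sigma> * (norm (y - x))\<^sup>2) + (- 2 * \<sigma>) *\<^sub>R (x - z) \<bullet> (y - x)"
        unfolding d2 by (simp add: distrib_left)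
      then have "E * exp (- s) * ?G y \<le> exp (- \<sigma> * (dist y z)\<^sup>2)"
        using ys unfolding E_def by (simp flip: exp_add)
      then have "k * ?G y \<le> b * exp (- \<sigma> * (dist y z)\<^sup>2)"
        unfolding k_def using mult_left_mono[OF _ b] by (simp add: mult.assoc)
      then show "w y \<le> a + - k * ?G y" using le[OF y] by simp
    qed
    also have "\<dots> = a - k * ball_average \<epsilon> ?G x"
      by (simp only: ball_average_add[OF ia ikG] ball_average_mult ball_average_const[OF \<epsilon>])
    also have "\<dots> \<le> a - k * (1 + 4 * moment_const TYPE('a) * (\<sigma> * t * \<epsilon>)\<^sup>2)"
    proof -
      have "norm ((- 2 * \<sigma>) *\<^sub>R (x - z)) = 2 * \<sigma> * t" using \<sigma> unfolding t_def dist_norm by simp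
      then have "1 + moment_const TYPE('a) * (2 * \<sigma> * t * \<epsilon>)\<^sup>2 \<le> ball_average \<epsilon> ?G x"
        using ball_average_exp_ge[OF \<epsilon>, of "(- 2 * \<sigma>) *\<^sub>R (x - z)" x] by simp
      moreover have "moment_const TYPE('a) * (2 * \<sigma> * t * \<epsilon>)\<^sup>2 = 4 * moment_const TYPE('a) * (\<sigma> * t * \<epsilon>)\<^sup>2"
        by (simp add: power2_eq_square)
      ultimately show ?thesis using k0 by (intro diff_left_mono mult_left_mono) auto
    qed
    also have "\<dots> \<le> a - b * E * (1 + s)"
    proof -
      have "b * E * (1 + s) \<le> b * E * (exp (- s) * (1 + 4 * moment_const TYPE('a) * (\<sigma> * t * \<epsilon>)\<^sup>2))"
        using exp_decay_growth[OF s0 q] bE by (intro mult_left_mono) auto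
      then show ?thesis unfolding k_def by (simp add: mult.assoc)
    qed
    finally show ?thesis by (simp add: mult.assoc)
  qed
  have "game_mean \<alpha> \<beta> \<epsilon> w x = \<alpha> / 2 * ((SUP y\<in>?B. w y) + (INF y\<in>?B. w y)) + \<beta> * ball_average \<epsilon> w x"
    unfolding game_mean_def by (simp add: distrib_left)
  also have "\<dots> \<le> \<alpha> / 2 * (2 * (a - b * (E * (1 + s)))) + \<beta> * (a - b * (E * (1 + s)))"
    using 1 2 \<alpha>\<beta> by (intro add_mono mult_left_mono) auto
  also have "\<dots> = (\<alpha> + \<beta>) * (a - b * (E * (1 + s)))" by (simp add: algebra_simps)
  finally show ?thesis using \<alpha>\<beta>(3) unfolding E_def s_def t_def by simp
qed

text \<open>
  Since the barrier gains a fixed amount \<open>\<kappa> > 0\<close> in each step on the bounded set \<open>D\<close>, a positive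
  supremum \<open>S\<close> of \<open>w - V\<close> over \<open>D\<close> would be at most \<open>S - \<kappa>\<close>. Strictness spares any argument about
  points where the supremum is attained. The condition is imposed only at points where \<open>w \<le> V\<close> is
  not already known, so that an obstacle below the barrier, and a boundary layer of \<open>D\<close> where
  \<open>w \<le> V\<close> holds for other reasons, are covered as well.
\<close>

lemma gaussian_barrier_comparison:
  fixes w :: "'a::euclidean_space \<Rightarrow> real"
  assumes \<alpha>\<beta>: "0 \<le> \<alpha>" "0 \<le> \<beta>" "\<alpha> + \<beta> = 1" and \<epsilon>: "0 < \<epsilon>" and \<sigma>: "0 < \<sigma>"
    and \<sigma>\<epsilon>: "\<sigma> * \<epsilon>\<^sup>2 \<le> 1 / 2" and \<sigma>\<rho>: "1 \<le> moment_const TYPE('a) * \<sigma> * \<rho>\<^sup>2" and \<rho>: "0 \<le> \<rho>" and b: "0 < b"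
    and D: "bounded D" and w: "bdd_above (w ` D)"
    and V: "\<And>y. V y = a - b * exp (- \<sigma> * (dist y z)\<^sup>2)"
    and dpp: "\<And>x. x \<in> D \<Longrightarrow> w x \<le> V x \<or>
        bounded_borel_on (ball x \<epsilon>) w \<and> w x \<le> game_mean \<alpha> \<beta> \<epsilon> w x \<and> \<rho> \<le> dist x z \<and>
        (\<forall>y\<in>ball x \<epsilon>. y \<in> D \<or> w y \<le> V y)"
    and x: "x \<in> D"
  shows "w x \<le> V x"
proof (rule ccontr)
  assume neg: "\<not> w x \<le> V x"
  define S where "S = (SUP y\<in>D. w y - V y)"
  have bdd: "bdd_above ((\<lambda>y. w y - V y) ` D)"
  proof -
    obtain C where C: "\<And>y. y \<in> D \<Longrightarrow> w y \<le> C" using w unfolding bdd_above_def by auto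
    have "V y \<ge> a - b" for y
      using b \<sigma> mult_left_mono[of "exp (- \<sigma> * (dist y z)\<^sup>2)" 1 b] unfolding V by simp
    then have "w y - V y \<le> C - (a - b)" if "y \<in> D" for y using C[OF that] by (simp add: diff_mono)
    then show ?thesis unfolding bdd_above_def by auto
  qed
  have S_upper: "w y - V y \<le> S" if "y \<in> D" for y unfolding S_def by (rule cSUP_upper[OF that bdd])
  have S0: "0 < S" using S_upper[OF x] neg by linarith
  obtain R where R: "\<And>y. y \<in> D \<Longrightarrow> dist y z \<le> R"
    using D bounded_any_center[of D z] by (auto simp: dist_commute)
  define \<kappa> where "\<kappa> = b * exp (- \<sigma> * R\<^sup>2) * (\<sigma> * \<epsilon>\<^sup>2)"
  have \<kappa>: "0 < \<kappa>" unfolding \<kappa>_def using b \<sigma> \<epsilon> by simp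
  have step: "w y - V y \<le> max 0 (S - \<kappa>)" if y: "y \<in> D" for y
  proof (cases "w y \<le> V y")
    case False
    then have bb: "bounded_borel_on (ball y \<epsilon>) w" and sub: "w y \<le> game_mean \<alpha> \<beta> \<epsilon> w y"
      and far: "\<rho> \<le> dist y z" and nb: "\<forall>y'\<in>ball y \<epsilon>. y' \<in> D \<or> w y' \<le> V y'"
      using dpp[OF y] by auto
    have "w y' \<le> (a + S) - b * exp (- \<sigma> * (dist y' z)\<^sup>2)" if "y' \<in> ball y \<epsilon>" for y'
      using nb that S_upper[of y'] S0 unfolding V by fastforce
    moreover have "1 \<le> moment_const TYPE('a) * \<sigma> * (dist y z)\<^sup>2"
    proof -
      have "\<rho>\<^sup>2 \<le> (dist y z)\<^sup>2" using far \<rho> by (intro power_mono) auto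
      then have "moment_const TYPE('a) * \<sigma> * \<rho>\<^sup>2 \<le> moment_const TYPE('a) * \<sigma> * (dist y z)\<^sup>2"
        using \<sigma> moment_const_bounds(1)[where 'a='a] by (intro mult_left_mono) auto
      then show ?thesis using \<sigma>\<rho> by linarith
    qed
    ultimately have "game_mean \<alpha> \<beta> \<epsilon> w y \<le> (a + S) - b * (exp (- \<sigma> * (dist y z)\<^sup>2) * (1 + \<sigma> * \<epsilon>\<^sup>2))"
      using b by (intro game_mean_gaussian_le \<alpha>\<beta> \<epsilon> \<sigma> \<sigma>\<epsilon> bb) auto
    moreover have "b * exp (- \<sigma> * R\<^sup>2) * (\<sigma> * \<epsilon>\<^sup>2) \<le> b * exp (- \<sigma> * (dist y z)\<^sup>2) * (\<sigma> * \<epsilon>\<^sup>2)"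
      using b \<sigma> power_mono[OF R[OF y], of 2] by (intro mult_right_mono mult_left_mono) auto
    ultimately have "w y - V y \<le> S - \<kappa>" using sub unfolding V \<kappa>_def by (simp add: algebra_simps)
    then show ?thesis by simp
  qed simp
  have "S \<le> max 0 (S - \<kappa>)" unfolding S_def using x step by (intro cSUP_least) (auto simp: S_def)
  then show False using S0 \<kappa> by auto
qed

section \<open>Exterior corkscrew points of Lipschitz domains\<close>

text \<open>
  Going from a boundary point \<open>z\<close> straight down by \<open>t\<close>, one gets so far below the graph that a ball
  of radius comparable to \<open>t\<close> stays below it: over horizontal distance \<open>s\<close> the graph descends by at
  most \<open>L * s\<close>.
\<close>

lemma lipschitz_graph_corkscrew:
  fixes \<Omega> :: "'a::euclidean_space set"
  assumes "open \<Omega>" "0 < r" and e: "norm e = 1" and \<phi>: "L-lipschitz_on {v. e \<bullet> v = 0} \<phi>"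
    and graph: "\<Omega> \<inter> ball z\<^sub>0 r = {y \<in> ball z\<^sub>0 r. \<phi> (y - (e \<bullet> y) *\<^sub>R e) < e \<bullet> y}"
    and z: "z \<in> frontier \<Omega>" "dist z\<^sub>0 z < r / 2" and t: "0 < t" "t \<le> r / 4"
  shows "ball (z - t *\<^sub>R e) (t / (1 + 2 * L)) \<inter> \<Omega> = {}"
proof -
  let ?P = "\<lambda>y. y - (e \<bullet> y) *\<^sub>R e"
  have L: "0 \<le> L" using \<phi> by (rule lipschitz_on_nonneg)
  have ee: "e \<bullet> e = 1" using e by (simp add: dot_square_norm)
  have graph': "y \<in> \<Omega> \<longleftrightarrow> \<phi> (?P y) < e \<bullet> y" if "dist z\<^sub>0 y < r" for y
    using arg_cong[OF graph, of "\<lambda>A. y \<in> A"] that by simp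
  have P: "?P y \<in> {v. e \<bullet> v = 0}" for y by (simp add: inner_diff_right ee)
  have "z \<notin> \<Omega>" using z(1) \<open>open \<Omega>\<close> by (simp add: frontier_def interior_open)
  then have z_below: "e \<bullet> z \<le> \<phi> (?P z)" using graph'[of z] z(2) \<open>0 < r\<close> by simp
  have "y \<notin> \<Omega>" if y: "dist (z - t *\<^sub>R e) y < t / (1 + 2 * L)" for y
  proof
    assume "y \<in> \<Omega>"
    define d where "d = y - (z - t *\<^sub>R e)"
    have d: "norm d < t / (1 + 2 * L)" using y unfolding d_def by (simp add: dist_norm norm_minus_commute)
    have ed: "\<bar>e \<bullet> d\<bar> \<le> norm d" using Cauchy_Schwarz_ineq2[of e d] e by simp
    have dt: "norm d \<le> t" using d L t frac_le[of t t 1 "1 + 2 * L"] by simp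
    have "norm (y - z) \<le> norm d + norm (t *\<^sub>R e)"
      unfolding d_def using norm_triangle_ineq4[of "y - (z - t *\<^sub>R e)" "t *\<^sub>R e"] by simp
    then have "dist z y \<le> 2 * t" using dt t e by (simp add: dist_norm norm_minus_commute)
    then have "dist z\<^sub>0 y < r" using dist_triangle[of z\<^sub>0 y z] z(2) t by linarith
    then have "\<phi> (?P y) < e \<bullet> y" using graph' \<open>y \<in> \<Omega>\<close> by simp
    \<comment> \<open>The vertical displacement t disappears under the projection, which at most doubles norm d.\<close>
    moreover have "\<phi> (?P z) - \<phi> (?P y) \<le> L * (2 * norm d)"
    proof -
      have "?P y - ?P z = d - (e \<bullet> d) *\<^sub>R e"
        unfolding d_def by (simp add: inner_diff_right inner_add_right ee algebra_simps)
      then have "norm (?P y - ?P z) \<le> norm d + norm ((e \<bullet> d) *\<^sub>R e)"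
        using norm_triangle_ineq4[of d "(e \<bullet> d) *\<^sub>R e"] by simp
      then have "norm (?P y - ?P z) \<le> 2 * norm d" using ed e by simp
      then have "L * dist (?P z) (?P y) \<le> L * (2 * norm d)"
        using L by (intro mult_left_mono) (auto simp: dist_norm norm_minus_commute)
      moreover have "dist (\<phi> (?P z)) (\<phi> (?P y)) \<le> L * dist (?P z) (?P y)"
        using lipschitz_onD[OF \<phi> P P] .
      ultimately show ?thesis by (simp add: dist_real_def)
    qed
    moreover have "e \<bullet> y = e \<bullet> z - t + e \<bullet> d"
      unfolding d_def by (simp add: inner_diff_right inner_add_right ee)
    moreover have "norm d + L * (2 * norm d) < t"
    proof -
      have "norm d * (1 + 2 * L) < t" using d L by (simp add: pos_less_divide_eq)
      then show ?thesis by (simp add: algebra_simps)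
    qed
    ultimately show False using z_below ed by linarith
  qed
  then show ?thesis by auto
qed

definition exterior_corkscrew :: "real \<Rightarrow> real \<Rightarrow> 'a::euclidean_space set \<Rightarrow> bool" where
  "exterior_corkscrew \<mu> t\<^sub>0 \<Omega> \<longleftrightarrow>
    (\<forall>z\<in>frontier \<Omega>. \<forall>t. 0 < t \<and> t \<le> t\<^sub>0 \<longrightarrow> (\<exists>c. dist z c \<le> t \<and> ball c (\<mu> * t) \<inter> \<Omega> = {}))"

text \<open>
  The aperture \<open>\<mu>\<close> and the scale \<open>t\<^sub>0\<close> can be chosen uniformly since finitely many of the local
  charts cover the compact boundary.
\<close>

lemma lipschitz_boundary_corkscrew:
  fixes \<Omega> :: "'a::euclidean_space set"
  assumes "open \<Omega>" "bounded \<Omega>" "lipschitz_boundary \<Omega>"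
  obtains \<mu> t\<^sub>0 where "0 < \<mu>" "\<mu> \<le> 1" "0 < t\<^sub>0" "exterior_corkscrew \<mu> t\<^sub>0 \<Omega>"
proof -
  define Q where "Q z\<^sub>0 s m \<longleftrightarrow> 0 < s \<and> 0 < m \<and> m \<le> 1 \<and>
    (\<forall>z\<in>frontier \<Omega> \<inter> ball z\<^sub>0 s. \<forall>t. 0 < t \<and> t \<le> s \<longrightarrow>
      (\<exists>c. dist z c \<le> t \<and> ball c (m * t) \<inter> \<Omega> = {}))" for z\<^sub>0 :: 'a and s m :: real
  have "\<exists>s m. Q z\<^sub>0 s m" if z0: "z\<^sub>0 \<in> frontier \<Omega>" for z\<^sub>0
  proof -
    obtain r e \<phi> L where r: "0 < r" "norm e = 1" "L-lipschitz_on {v. e \<bullet> v = 0} \<phi>"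
      "\<Omega> \<inter> ball z\<^sub>0 r = {y \<in> ball z\<^sub>0 r. \<phi> (y - (e \<bullet> y) *\<^sub>R e) < e \<bullet> y}"
      using assms(3) z0 unfolding lipschitz_boundary_def by meson
    have L: "0 \<le> L" using r(3) by (rule lipschitz_on_nonneg)
    have "\<exists>c. dist z c \<le> t \<and> ball c (1 / (1 + 2 * L) * t) \<inter> \<Omega> = {}"
      if "z \<in> frontier \<Omega> \<inter> ball z\<^sub>0 (r / 4)" "0 < t" "t \<le> r / 4" for z t
    proof (intro exI conjI)
      show "dist z (z - t *\<^sub>R e) \<le> t" using that r(2) by (simp add: dist_norm)
      show "ball (z - t *\<^sub>R e) (1 / (1 + 2 * L) * t) \<inter> \<Omega> = {}"
        using lipschitz_graph_corkscrew[OF assms(1) r, of z t] that r(1) by simp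
    qed
    then have "Q z\<^sub>0 (r / 4) (1 / (1 + 2 * L))" using r(1) L unfolding Q_def by auto
    then show ?thesis by blast
  qed
  then obtain s m where sm: "\<And>z\<^sub>0. z\<^sub>0 \<in> frontier \<Omega> \<Longrightarrow> Q z\<^sub>0 (s z\<^sub>0) (m z\<^sub>0)" by metis
  have "compact (frontier \<Omega>)" using assms(2) by (simp add: compact_frontier_bounded)
  then obtain Z where Z: "Z \<subseteq> frontier \<Omega>" "finite Z" "frontier \<Omega> \<subseteq> (\<Union>z\<^sub>0\<in>Z. ball z\<^sub>0 (s z\<^sub>0))"
  proof (rule compactE_image[of "frontier \<Omega>" "frontier \<Omega>" "\<lambda>z\<^sub>0. ball z\<^sub>0 (s z\<^sub>0)"])
    show "frontier \<Omega> \<subseteq> (\<Union>z\<^sub>0\<in>frontier \<Omega>. ball z\<^sub>0 (s z\<^sub>0))" using sm unfolding Q_def by force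
  qed auto
  define \<mu> where "\<mu> = Min (insert 1 (m ` Z))"
  define t\<^sub>0 where "t\<^sub>0 = Min (insert 1 (s ` Z))"
  have \<mu>: "0 < \<mu>" "\<mu> \<le> 1" and t0: "0 < t\<^sub>0"
    using Z(1,2) sm unfolding \<mu>_def t\<^sub>0_def Q_def by auto
  have "\<exists>c. dist z c \<le> t \<and> ball c (\<mu> * t) \<inter> \<Omega> = {}"
    if z: "z \<in> frontier \<Omega>" and t: "0 < t" "t \<le> t\<^sub>0" for z t
  proof -
    obtain z\<^sub>0 where z0: "z\<^sub>0 \<in> Z" "z \<in> ball z\<^sub>0 (s z\<^sub>0)" using Z(3) z by auto
    have "t\<^sub>0 \<le> s z\<^sub>0" "\<mu> \<le> m z\<^sub>0" using Z(2) z0(1) unfolding \<mu>_def t\<^sub>0_def by auto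
    then obtain c where c: "dist z c \<le> t" "ball c (m z\<^sub>0 * t) \<inter> \<Omega> = {}"
      using sm[of z\<^sub>0] z0 z t Z(1) unfolding Q_def by (meson IntI order_trans subsetD)
    have "ball c (\<mu> * t) \<subseteq> ball c (m z\<^sub>0 * t)"
      using \<open>\<mu> \<le> m z\<^sub>0\<close> t by (intro subset_ball mult_right_mono) auto
    then show ?thesis using c by auto
  qed
  then show ?thesis using that[OF \<mu> t0] unfolding exterior_corkscrew_def by auto
qed

section \<open>Decay of the oscillation at the boundary\<close>

text \<open>
  The quotient of the barrier \<open>1 - exp (\<sigma> * \<rho>\<^sup>2 - \<sigma> * s\<^sup>2)\<close> at the distances \<open>s = 2 * t\<close> and
  \<open>s = 3 * t\<close> from its centre, where \<open>\<rho> = \<mu> * t / 2\<close> and \<open>\<sigma> = 1 / (moment_const T * \<rho>\<^sup>2)\<close>. The scale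
  \<open>t\<close> cancels, and this is why the estimate below can be iterated.
\<close>

definition decay_factor :: "'a::euclidean_space itself \<Rightarrow> real \<Rightarrow> real" where
  "decay_factor T \<mu> =
    (1 - exp (1 / moment_const T - 16 / (moment_const T * \<mu>\<^sup>2))) /
    (1 - exp (1 / moment_const T - 36 / (moment_const T * \<mu>\<^sup>2)))"

lemma decay_factor_ordering:
  assumes "0 < \<mu>" "\<mu> \<le> 1"
  shows "exp (1 / moment_const TYPE('a::euclidean_space) - 36 / (moment_const TYPE('a) * \<mu>\<^sup>2))
      < exp (1 / moment_const TYPE('a) - 16 / (moment_const TYPE('a) * \<mu>\<^sup>2))"
    "exp (1 / moment_const TYPE('a) - 16 / (moment_const TYPE('a) * \<mu>\<^sup>2)) < 1"
proof -
  let ?c = "moment_const TYPE('a)"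
  have c: "0 < ?c" by (rule moment_const_bounds)
  have \<mu>2: "0 < \<mu>\<^sup>2" "\<mu>\<^sup>2 \<le> 1" using assms power_le_one[of \<mu> 2] by auto
  have p: "0 < ?c * \<mu>\<^sup>2" "?c * \<mu>\<^sup>2 \<le> ?c" using c \<mu>2 by auto
  show "exp (1 / ?c - 36 / (?c * \<mu>\<^sup>2)) < exp (1 / ?c - 16 / (?c * \<mu>\<^sup>2))"
    using p by (simp add: divide_strict_right_mono)
  have "1 / ?c \<le> 1 / (?c * \<mu>\<^sup>2)" using p by (intro divide_left_mono) auto
  also have "\<dots> < 16 / (?c * \<mu>\<^sup>2)" using p by (simp add: divide_strict_right_mono)
  finally show "exp (1 / ?c - 16 / (?c * \<mu>\<^sup>2)) < 1" by simp
qed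

lemma decay_factor_bounds:
  assumes "0 < \<mu>" "\<mu> \<le> 1"
  shows "0 < decay_factor TYPE('a::euclidean_space) \<mu>" "decay_factor TYPE('a) \<mu> < 1"
  using decay_factor_ordering[OF assms, where 'a='a] unfolding decay_factor_def by (auto simp: divide_simps)

text \<open>
  The barrier is centred at the exterior corkscrew point \<open>c\<close> and scaled to vanish at distance
  \<open>\<rho> = \<mu> * t / 2\<close> from \<open>c\<close>, to be at least \<open>M - m\<close> at distance \<open>3 * t\<close>, hence near the boundary of
  \<open>ball z (5 * t)\<close>, and at most \<open>decay_factor TYPE('a) \<mu> * (M - m)\<close> up to distance \<open>2 * t\<close>, hence on
  \<open>ball z t\<close>. Points of \<open>\<Omega>\<close> have distance at least \<open>2 * \<rho>\<close> from \<open>c\<close>; as \<open>\<epsilon> \<le> \<rho>\<close>, the points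
  reached from them in one step keep the distance \<open>\<rho>\<close>, where the barrier is nonnegative. Thus
  \<open>w - m\<close> lies below the barrier outside \<open>\<Omega>\<close> and near the sphere of radius \<open>5 * t\<close>, and
  comparison does the rest.
\<close>

lemma boundary_oscillation_decay:
  fixes w :: "'a::euclidean_space \<Rightarrow> real"
  assumes \<alpha>\<beta>: "0 \<le> \<alpha>" "0 \<le> \<beta>" "\<alpha> + \<beta> = 1" and \<mu>: "0 < \<mu>" "\<mu> \<le> 1"
    and \<epsilon>: "0 < \<epsilon>" and \<epsilon>t: "\<epsilon> \<le> moment_const TYPE('a) * \<mu> / 8 * t"
    and c: "dist z c \<le> t" "ball c (\<mu> * t) \<inter> \<Omega> = {}"
    and mM: "m < M" and w: "bounded_borel_on X w" and X: "\<And>x. x \<in> \<Omega> \<Longrightarrow> ball x \<epsilon> \<subseteq> X"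
    and upper: "\<And>x. x \<in> \<Omega> \<Longrightarrow> dist z x < 5 * t \<Longrightarrow> w x \<le> M"
    and outside: "\<And>x. x \<in> X - \<Omega> \<Longrightarrow> dist z x < 5 * t \<Longrightarrow> w x \<le> m"
    and dpp: "\<And>x. x \<in> \<Omega> \<Longrightarrow> dist z x < 5 * t \<Longrightarrow> w x \<le> m \<or> w x \<le> game_mean \<alpha> \<beta> \<epsilon> w x"
    and x: "x \<in> \<Omega>" "dist z x < t"
  shows "w x \<le> m + decay_factor TYPE('a) \<mu> * (M - m)"
proof -
  define k where "k = moment_const TYPE('a)"
  have k: "0 < k" "k \<le> 1 / 2" unfolding k_def by (rule moment_const_bounds)+
  have t: "0 < t" using x(2) zero_le_dist[of z x] by linarith
  define \<rho> where "\<rho> = \<mu> * t / 2"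
  have \<rho>: "0 < \<rho>" "\<rho> \<le> t" unfolding \<rho>_def using \<mu> t mult_left_le_one_le[of t \<mu>] by auto
  have \<epsilon>k: "\<epsilon> \<le> k * \<rho> / 4" using \<epsilon>t unfolding k_def \<rho>_def by simp
  also have "\<dots> \<le> 1 / 2 * \<rho> / 4" using k \<rho> by (intro divide_right_mono mult_right_mono) auto
  finally have \<epsilon>\<rho>: "\<epsilon> \<le> \<rho>" using \<rho> by simp
  define \<sigma> where "\<sigma> = 1 / (k * \<rho>\<^sup>2)"
  have \<sigma>: "0 < \<sigma>" unfolding \<sigma>_def using k \<rho> by simp
  have \<sigma>\<rho>: "k * \<sigma> * \<rho>\<^sup>2 = 1" "\<sigma> * \<rho>\<^sup>2 = 1 / k" unfolding \<sigma>_def using k \<rho> by simp_all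
  have \<sigma>t: "\<sigma> * t\<^sup>2 = 4 / (k * \<mu>\<^sup>2)"
    unfolding \<sigma>_def \<rho>_def using t by (simp add: power_divide power_mult_distrib field_simps)
  have \<sigma>t': "\<sigma> * (3 * t)\<^sup>2 = 36 / (k * \<mu>\<^sup>2)" "\<sigma> * (2 * t)\<^sup>2 = 16 / (k * \<mu>\<^sup>2)"
    using \<sigma>t by (simp_all add: power_mult_distrib mult.left_commute[of \<sigma>])
  have \<sigma>\<epsilon>: "\<sigma> * \<epsilon>\<^sup>2 \<le> 1 / 2"
  proof -
    have "\<sigma> * \<epsilon>\<^sup>2 \<le> \<sigma> * (k * \<rho> / 4)\<^sup>2" using \<epsilon> \<epsilon>k \<sigma> by (intro mult_left_mono power_mono) auto
    also have "\<dots> = k / 16" using \<sigma>\<rho> k unfolding power_divide power_mult_distrib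
      by (simp add: field_simps power2_eq_square)
    finally show ?thesis using k by simp
  qed
  define G where "G y = 1 - exp (1 / k - \<sigma> * (dist y c)\<^sup>2)" for y
  define g0 g1 where "g0 = 1 - exp (1 / k - 16 / (k * \<mu>\<^sup>2))" and "g1 = 1 - exp (1 / k - 36 / (k * \<mu>\<^sup>2))"
  have g1: "0 < g1" using decay_factor_ordering[OF \<mu>, where 'a='a] unfolding g1_def k_def by simp
  have G_mono: "1 - exp (1 / k - \<sigma> * s\<^sup>2) \<le> G y" if "0 \<le> s" "s \<le> dist y c" for s y
    using that \<sigma> power_mono[of s "dist y c" 2] unfolding G_def by simp
  have G_nonneg: "0 \<le> G y" if "\<rho> \<le> dist y c" for y
    using G_mono[OF _ that] \<rho> \<sigma>\<rho>(2) by simp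
  define V where "V y = m + (M - m) / g1 * G y" for y
  have V_ge: "m \<le> V y" if "\<rho> \<le> dist y c" for y
    using G_nonneg[OF that] mM g1 unfolding V_def by simp
  have c_far: "2 * \<rho> \<le> dist y c" if "y \<in> \<Omega>" for y
    using c(2) that unfolding \<rho>_def by (auto simp: disjoint_iff dist_commute not_less)
  have V_eq: "V y = (m + (M - m) / g1) - (M - m) / g1 * exp (1 / k) * exp (- \<sigma> * (dist y c)\<^sup>2)" for y
  proof -
    have "exp (1 / k - \<sigma> * (dist y c)\<^sup>2) = exp (1 / k) * exp (- \<sigma> * (dist y c)\<^sup>2)"
      by (simp flip: exp_add)
    then show ?thesis unfolding V_def G_def by (simp add: right_diff_distrib)
  qed
  have "w x \<le> V x"
  proof (rule gaussian_barrier_comparison[OF \<alpha>\<beta> \<epsilon> \<sigma> \<sigma>\<epsilon>, where D = "\<Omega> \<inter> ball z (5 * t)" and z = c and \<rho> = \<rho> and V = V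
        and a = "m + (M - m) / g1" and b = "(M - m) / g1 * exp (1 / k)"])
    show "1 \<le> moment_const TYPE('a) * \<sigma> * \<rho>\<^sup>2" using \<sigma>\<rho>(1) unfolding k_def by simp
    show "bdd_above (w ` (\<Omega> \<inter> ball z (5 * t)))" using upper by (intro bdd_aboveI[of _ M]) auto
    show "V y = (m + (M - m) / g1) - (M - m) / g1 * exp (1 / k) * exp (- \<sigma> * (dist y c)\<^sup>2)" for y
      by (rule V_eq)
    fix y assume "y \<in> \<Omega> \<inter> ball z (5 * t)"
    then have y: "y \<in> \<Omega>" "dist z y < 5 * t" by auto
    show "w y \<le> V y \<or> bounded_borel_on (ball y \<epsilon>) w \<and> w y \<le> game_mean \<alpha> \<beta> \<epsilon> w y \<and> \<rho> \<le> dist y c \<and>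
        (\<forall>y'\<in>ball y \<epsilon>. y' \<in> \<Omega> \<inter> ball z (5 * t) \<or> w y' \<le> V y')"
    \<comment> \<open>In the outer layer one step may leave the ball, but there the barrier V is at least M.\<close>
    proof (cases "5 * t - \<epsilon> \<le> dist z y")
      case True
      then have "3 * t \<le> dist y c"
        using dist_triangle[of z y c] c(1) \<epsilon>\<rho> \<rho> by (simp add: dist_commute)
      then have "g1 \<le> G y" using G_mono[of "3 * t" y] t unfolding g1_def \<sigma>t' by simp
      then have "(M - m) / g1 * g1 \<le> (M - m) / g1 * G y" using mM g1 by (intro mult_left_mono) auto
      then have "M \<le> V y" using g1 unfolding V_def by simp
      then show ?thesis using upper[OF y] by linarith
    next
      case False
      have near: "dist z y' < 5 * t \<and> \<rho> \<le> dist y' c" if "y' \<in> ball y \<epsilon>" for y'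
        using that False dist_triangle[of z y' y] dist_triangle[of y c y'] c_far[OF y(1)] \<epsilon>\<rho> by auto
      have "w y' \<le> V y'" if "y' \<in> ball y \<epsilon>" "y' \<notin> \<Omega>" for y'
        using outside[of y'] X[OF y(1)] near[OF that(1)] V_ge[of y'] that by force
      then have "\<forall>y'\<in>ball y \<epsilon>. y' \<in> \<Omega> \<inter> ball z (5 * t) \<or> w y' \<le> V y'"
        using near by (metis IntI mem_ball)
      moreover have "\<rho> \<le> dist y c" using c_far[OF y(1)] \<rho> by linarith
      ultimately show ?thesis
        using dpp[OF y] V_ge[of y] bounded_borel_on_subset[OF w X[OF y(1)]] by auto
    qed
  qed (use \<rho> mM g1 x t in \<open>auto simp: bounded_Int\<close>)
  also have "V x \<le> m + (M - m) / g1 * g0"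
  proof -
    have "dist x c \<le> 2 * t" using dist_triangle[of x c z] x(2) c(1) by (simp add: dist_commute)
    then have "\<sigma> * (dist x c)\<^sup>2 \<le> \<sigma> * (2 * t)\<^sup>2"
      using \<sigma> by (intro mult_left_mono power_mono) auto
    then have "G x \<le> g0" unfolding G_def g0_def \<sigma>t' by simp
    then show ?thesis unfolding V_def using mM g1 by (intro add_left_mono mult_left_mono) auto
  qed
  also have "\<dots> = m + decay_factor TYPE('a) \<mu> * (M - m)"
    unfolding decay_factor_def g0_def g1_def k_def by simp
  finally show ?thesis .
qed

text \<open>
  Shrinking the radius by the factor \<open>5\<close> multiplies the excess over \<open>m\<close> by the same factor each
  time. The level \<open>m\<close> need not change from scale to scale, because the oscillation of the data on
  the largest ball is put into \<open>m\<close> at the start; the number of iterations is limited only by the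
  step size \<open>\<epsilon>\<close>, which must remain small relative to the last radius.
\<close>

lemma boundary_oscillation_iterate:
  fixes w :: "'a::euclidean_space \<Rightarrow> real"
  assumes \<alpha>\<beta>: "0 \<le> \<alpha>" "0 \<le> \<beta>" "\<alpha> + \<beta> = 1" and \<mu>: "0 < \<mu>" "\<mu> \<le> 1"
    and cork: "exterior_corkscrew \<mu> t\<^sub>0 \<Omega>" and z: "z \<in> frontier \<Omega>" and R: "0 < R" "R \<le> 5 * t\<^sub>0"
    and \<epsilon>: "0 < \<epsilon>" "\<epsilon> \<le> moment_const TYPE('a) * \<mu> / 8 * (R / 5 ^ n)"
    and mM: "m < M" and w: "bounded_borel_on X w" and X: "\<And>x. x \<in> \<Omega> \<Longrightarrow> ball x \<epsilon> \<subseteq> X"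
    and upper: "\<And>x. x \<in> \<Omega> \<Longrightarrow> w x \<le> M"
    and outside: "\<And>x. x \<in> X - \<Omega> \<Longrightarrow> dist z x < R \<Longrightarrow> w x \<le> m"
    and dpp: "\<And>x. x \<in> \<Omega> \<Longrightarrow> dist z x < R \<Longrightarrow> w x \<le> m \<or> w x \<le> game_mean \<alpha> \<beta> \<epsilon> w x"
    and x: "x \<in> \<Omega>" "dist z x < R / 5 ^ n"
  shows "w x \<le> m + decay_factor TYPE('a) \<mu> ^ n * (M - m)"
  using \<epsilon>(2) x
proof (induction n arbitrary: x)
  case 0
  then show ?case using upper by simp
next
  case (Suc n)
  define \<theta> where "\<theta> = decay_factor TYPE('a) \<mu>"
  define t where "t = R / 5 ^ Suc n"
  have \<theta>: "0 < \<theta>" using decay_factor_bounds[OF \<mu>, where 'a='a] unfolding \<theta>_def by simp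
  have t: "0 < t" "5 * t = R / 5 ^ n" "R / 5 ^ n \<le> R"
    unfolding t_def using R by (auto simp: divide_le_eq)
  then have "t \<le> t\<^sub>0" using R by linarith
  then obtain c where c: "dist z c \<le> t" "ball c (\<mu> * t) \<inter> \<Omega> = {}"
    using cork z t(1) unfolding exterior_corkscrew_def by blast
  have \<epsilon>n: "\<epsilon> \<le> moment_const TYPE('a) * \<mu> / 8 * (R / 5 ^ n)"
  proof -
    have "moment_const TYPE('a) * \<mu> / 8 * t \<le> moment_const TYPE('a) * \<mu> / 8 * (R / 5 ^ n)"
      using t \<mu> moment_const_bounds(1)[where 'a='a] by (intro mult_left_mono) auto
    then show ?thesis using Suc.prems(1) unfolding t_def by linarith
  qed
  have "w x \<le> m + \<theta> * ((m + \<theta> ^ n * (M - m)) - m)"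
    unfolding \<theta>_def
  proof (rule boundary_oscillation_decay[OF \<alpha>\<beta> \<mu> \<epsilon>(1) _ c _ w X])
    show "\<epsilon> \<le> moment_const TYPE('a) * \<mu> / 8 * t" using Suc.prems(1) unfolding t_def .
    show "m < m + decay_factor TYPE('a) \<mu> ^ n * (M - m)"
      using \<theta> mM unfolding \<theta>_def by simp
    show "w y \<le> m + decay_factor TYPE('a) \<mu> ^ n * (M - m)" if "y \<in> \<Omega>" "dist z y < 5 * t" for y
      using Suc.IH[OF \<epsilon>n] that t(2) by simp
    show "w y \<le> m" if "y \<in> X - \<Omega>" "dist z y < 5 * t" for y
      using outside that t by simp
    show "w y \<le> m \<or> w y \<le> game_mean \<alpha> \<beta> \<epsilon> w y" if "y \<in> \<Omega>" "dist z y < 5 * t" for y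
      using dpp that t by simp
    show "dist z x < t" using Suc.prems unfolding t_def by simp
  qed (use Suc.prems in auto)
  then show ?case unfolding \<theta>_def by simp
qed

text \<open>
  The number \<open>n\<close> of iterations depends on \<open>C\<close>, \<open>\<eta>\<close> and \<open>\<mu>\<close> only, so that the radius \<open>r\<close> and the
  bound \<open>\<epsilon>\<^sub>1\<close> serve all boundary points, step sizes and subsolutions at once.
\<close>

lemma boundary_modulus:
  fixes \<Omega> :: "'a::euclidean_space set"
  assumes \<alpha>\<beta>: "0 \<le> \<alpha>" "0 \<le> \<beta>" "\<alpha> + \<beta> = 1" and \<mu>: "0 < \<mu>" "\<mu> \<le> 1" and t0: "0 < t\<^sub>0"
    and cork: "exterior_corkscrew \<mu> t\<^sub>0 \<Omega>" and R: "0 < R" and \<eta>: "0 < \<eta>"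
  obtains r \<epsilon>\<^sub>1 where "0 < r" "0 < \<epsilon>\<^sub>1"
    "\<And>\<epsilon> X z m w x. \<lbrakk>0 < \<epsilon>; \<epsilon> < \<epsilon>\<^sub>1; z \<in> frontier \<Omega>; bounded_borel_on X w;
       \<And>x. x \<in> \<Omega> \<Longrightarrow> ball x \<epsilon> \<subseteq> X; \<And>x. x \<in> \<Omega> \<Longrightarrow> w x \<le> C; - C \<le> m;
       \<And>x. x \<in> X - \<Omega> \<Longrightarrow> dist z x < R \<Longrightarrow> w x \<le> m;
       \<And>x. x \<in> \<Omega> \<Longrightarrow> dist z x < R \<Longrightarrow> w x \<le> m \<or> w x \<le> game_mean \<alpha> \<beta> \<epsilon> w x;
       x \<in> \<Omega>; dist z x < r\<rbrakk> \<Longrightarrow> w x \<le> m + \<eta>"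
proof -
  define \<theta> where "\<theta> = decay_factor TYPE('a) \<mu>"
  have \<theta>: "0 < \<theta>" "\<theta> < 1" using decay_factor_bounds[OF \<mu>, where 'a='a] unfolding \<theta>_def by simp_all
  have "0 < \<eta> / (2 * \<bar>C\<bar> + 1)" using \<eta> by (intro divide_pos_pos) auto
  then obtain n where "\<theta> ^ n < \<eta> / (2 * \<bar>C\<bar> + 1)" using real_arch_pow_inv[OF _ \<theta>(2)] by blast
  then have n: "\<theta> ^ n * (2 * \<bar>C\<bar> + 1) < \<eta>" by (subst (asm) pos_less_divide_eq) auto
  define R' where "R' = min R (5 * t\<^sub>0)"
  have R': "0 < R'" "R' \<le> 5 * t\<^sub>0" "R' \<le> R" unfolding R'_def using R t0 by auto
  define r where "r = R' / 5 ^ n"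
  have r: "0 < r" unfolding r_def using R' by simp
  show ?thesis
  proof (rule that)
    show "0 < r" by (rule r)
    show "0 < moment_const TYPE('a) * \<mu> / 8 * r" using \<mu> r moment_const_bounds(1)[where 'a='a] by simp
    fix \<epsilon> X z m x and w :: "'a \<Rightarrow> real"
    assume \<epsilon>: "0 < \<epsilon>" "\<epsilon> < moment_const TYPE('a) * \<mu> / 8 * r" and z: "z \<in> frontier \<Omega>"
      and w: "bounded_borel_on X w" and X: "\<And>x. x \<in> \<Omega> \<Longrightarrow> ball x \<epsilon> \<subseteq> X"
      and C: "\<And>x. x \<in> \<Omega> \<Longrightarrow> w x \<le> C" and m: "- C \<le> m"
      and outside: "\<And>x. x \<in> X - \<Omega> \<Longrightarrow> dist z x < R \<Longrightarrow> w x \<le> m"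
      and dpp: "\<And>x. x \<in> \<Omega> \<Longrightarrow> dist z x < R \<Longrightarrow> w x \<le> m \<or> w x \<le> game_mean \<alpha> \<beta> \<epsilon> w x"
      and x: "x \<in> \<Omega>" "dist z x < r"
    show "w x \<le> m + \<eta>"
    proof (cases "m < C")
      case True
      have "w x \<le> m + \<theta> ^ n * (C - m)"
        unfolding \<theta>_def
        by (rule boundary_oscillation_iterate[OF \<alpha>\<beta> \<mu> cork z R'(1,2) \<epsilon>(1) _ True w X C])
          (use \<epsilon> x outside dpp R' in \<open>auto simp: r_def\<close>)
      also have "\<theta> ^ n * (C - m) \<le> \<theta> ^ n * (2 * \<bar>C\<bar> + 1)"
        using \<theta> m by (intro mult_left_mono) auto
      finally show ?thesis using n by linarith
    next
      case False
      then show ?thesis using C[OF x(1)] \<eta> by linarith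
    qed
  qed
qed

section \<open>Uniform bounds\<close>

text \<open>
  The constant \<open>C\<close> itself is a supersolution, but not a strict one. Adding a barrier that is
  centred far from \<open>\<Omega>\<close> and has values between \<open>0\<close> and \<open>1\<close> near \<open>\<Omega>\<close> makes it strict at the cost of
  the summand \<open>1\<close>, which is harmless since only uniformity in \<open>\<epsilon>\<close> matters.
\<close>

lemma subsolution_bounded_above:
  fixes \<Omega> :: "'a::euclidean_space set"
  assumes \<alpha>\<beta>: "0 \<le> \<alpha>" "0 \<le> \<beta>" "\<alpha> + \<beta> = 1" and \<Omega>: "bounded \<Omega>"
    and \<epsilon>: "0 < \<epsilon>" "\<epsilon> \<le> moment_const TYPE('a)"
    and w: "bounded_borel_on X w" and X: "\<And>x. x \<in> \<Omega> \<Longrightarrow> ball x \<epsilon> \<subseteq> X"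
    and outside: "\<And>x. x \<in> X - \<Omega> \<Longrightarrow> w x \<le> C"
    and dpp: "\<And>x. x \<in> \<Omega> \<Longrightarrow> w x \<le> C \<or> w x \<le> game_mean \<alpha> \<beta> \<epsilon> w x"
    and x: "x \<in> \<Omega>"
  shows "w x \<le> C + 1"
proof -
  define k where "k = moment_const TYPE('a)"
  have k: "0 < k" "k \<le> 1 / 2" unfolding k_def by (rule moment_const_bounds)+
  obtain R where R: "0 < R" "\<And>y. y \<in> \<Omega> \<Longrightarrow> norm y \<le> R" using \<Omega> by (auto simp: bounded_pos)
  obtain b :: 'a where b: "norm b = 1" using norm_Basis nonempty_Basis by blast
  define z where "z = (R + 2) *\<^sub>R b"
  have far: "2 \<le> dist y z" if "y \<in> \<Omega>" for y
    using R(2)[OF that] R(1) b norm_triangle_ineq2[of z y] unfolding z_def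
    by (simp add: dist_norm norm_minus_commute)
  have far': "1 \<le> dist y z" if "y' \<in> \<Omega>" "dist y' y < \<epsilon>" for y y'
    using far[OF that(1)] that(2) dist_triangle[of y' z y] \<epsilon> k unfolding k_def by linarith
  define V where "V y = (C + 1) - exp (1 / k) * exp (- (1 / k) * (dist y z)\<^sup>2)" for y
  have V_ge: "C \<le> V y" if "1 \<le> dist y z" for y
  proof -
    have "1 / k * 1 \<le> 1 / k * (dist y z)\<^sup>2" using k one_le_power[OF that, of 2] by (intro mult_left_mono) auto
    then show ?thesis unfolding V_def by (simp flip: exp_add)
  qed
  have "w x \<le> V x"
  proof (rule gaussian_barrier_comparison[OF \<alpha>\<beta> \<epsilon>(1), where D = \<Omega> and z = z and \<rho> = 1 and V = V
        and \<sigma> = "1 / k" and a = "C + 1" and b = "exp (1 / k)"])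
    have "\<epsilon>\<^sup>2 \<le> k\<^sup>2" using \<epsilon> unfolding k_def by (intro power_mono) auto
    also have "\<dots> \<le> 1 / 2 * k" using k unfolding power2_eq_square by (intro mult_right_mono) auto
    finally show "1 / k * \<epsilon>\<^sup>2 \<le> 1 / 2" using k by (simp add: field_simps)
    show "1 \<le> moment_const TYPE('a) * (1 / k) * 1\<^sup>2" using k unfolding k_def by simp
    have "\<Omega> \<subseteq> X" using X \<epsilon> by (meson centre_in_ball subset_iff)
    then show "bdd_above (w ` \<Omega>)"
      using bounded_borel_on_bdd(1)[OF w] bdd_above_mono image_mono by metis
    fix y assume y: "y \<in> \<Omega>"
    have nb: "w y' \<le> V y'" if "y' \<in> ball y \<epsilon>" "y' \<notin> \<Omega>" for y'
      using outside[of y'] X[OF y] V_ge[OF far'[OF y]] that by fastforce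
    show "w y \<le> V y \<or> bounded_borel_on (ball y \<epsilon>) w \<and> w y \<le> game_mean \<alpha> \<beta> \<epsilon> w y \<and> 1 \<le> dist y z \<and>
        (\<forall>y'\<in>ball y \<epsilon>. y' \<in> \<Omega> \<or> w y' \<le> V y')"
            using dpp[OF y]
    proof
      assume "w y \<le> C"
      then show ?thesis using V_ge[of y] far[OF y] by simp
    next
      assume "w y \<le> game_mean \<alpha> \<beta> \<epsilon> w y"
      then show ?thesis using nb far[OF y] bounded_borel_on_subset[OF w X[OF y]] by fastforce
    qed
  qed (use k x \<Omega> V_def in auto)
  also have "V x \<le> C + 1" unfolding V_def by simp
  finally show ?thesis .
qed

section \<open>Comparison of a solution with its translates\<close>

text \<open>
  A translate of a solution solves the same equation for the translated obstacle, so the claim is a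
  comparison principle for two solutions. Here no strict barrier can be added to one of them,
  because the supremum and the infimum are not additive. Instead the difference \<open>f\<close> of the two sides
  is perturbed: where \<open>f > 0\<close>, it is at most \<open>\<alpha>\<close> times its supremum plus \<open>\<beta>\<close> times its average over
  the ball, and adding a small multiple of a steep exponential \<open>g\<close> makes this strict. The slope is
  chosen depending on \<open>\<epsilon>\<close> such that \<open>\<beta>\<close> times the average of \<open>g\<close> exceeds \<open>2 * g\<close>; this is possible
  since \<open>\<beta> > 0\<close>. The multiple then tends to \<open>0\<close>.
\<close>

lemma translation_comparison:
  fixes u :: "'a::euclidean_space \<Rightarrow> real"
  assumes \<alpha>\<beta>: "0 \<le> \<alpha>" "0 < \<beta>" "\<alpha> + \<beta> = 1" and \<epsilon>: "0 < \<epsilon>" and \<Omega>: "bounded \<Omega>"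
    and u: "bounded_borel_on X u" and X: "\<And>x. x \<in> \<Omega> \<Longrightarrow> ball x \<epsilon> \<subseteq> X"
    and dpp: "\<And>x. x \<in> \<Omega> \<Longrightarrow> u x = max (\<Psi> x) (game_mean \<alpha> \<beta> \<epsilon> u x)"
    and \<Psi>: "\<And>x. \<Psi> x \<le> \<Psi> (x + h) + \<eta>"
    and outside: "\<And>y. y \<in> X \<Longrightarrow> y + h \<in> X \<Longrightarrow> y \<notin> \<Omega> \<or> y + h \<notin> \<Omega> \<Longrightarrow> u y \<le> u (y + h) + \<eta>"
    and x: "x \<in> \<Omega>" "x + h \<in> \<Omega>"
  shows "u x \<le> u (x + h) + \<eta>"
proof -
  define k where "k = moment_const TYPE('a)"
  have k: "0 < k" unfolding k_def by (rule moment_const_bounds)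
  define D where "D = {y \<in> \<Omega>. y + h \<in> \<Omega>}"
  define f where "f y = u y - u (y + h) - \<eta>" for y
  obtain R where R: "0 < R" "\<And>y. y \<in> \<Omega> \<Longrightarrow> norm y \<le> R" using \<Omega> by (auto simp: bounded_pos)
  obtain e :: 'a where e: "norm e = 1" using norm_Basis nonempty_Basis by blast
  define a where "a = (sqrt (2 / (\<beta> * k)) / \<epsilon>) *\<^sub>R e"
  define g where "g y = exp (a \<bullet> y)" for y
  have ka: "\<beta> * (1 + k * (norm a * \<epsilon>)\<^sup>2) = \<beta> + 2"
    using \<alpha>\<beta>(2) k \<epsilon> e unfolding a_def by (simp add: field_simps)
  define T where "T = norm a * (R + \<epsilon>)"
  have ay: "\<bar>a \<bullet> y\<bar> \<le> T" if "y' \<in> \<Omega>" "dist y' y < \<epsilon>" for y y'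
  proof -
    have "norm y \<le> R + \<epsilon>"
      using R(2)[OF that(1)] that(2) norm_triangle_sub[of y y'] by (simp add: dist_norm norm_minus_commute)
    then have "norm a * norm y \<le> T" unfolding T_def by (intro mult_left_mono) auto
    then show ?thesis using Cauchy_Schwarz_ineq2[of a y] by linarith
  qed
  have g_le: "g y \<le> exp T" if "y' \<in> \<Omega>" "dist y' y < \<epsilon>" for y y'
    using ay[OF that] unfolding g_def by simp
  have g_ge: "exp (- T) \<le> g y" if "y \<in> \<Omega>" for y
    using ay[of y y] that \<epsilon> unfolding g_def by simp
  have g_int: "set_integrable lborel (ball y \<epsilon>) (\<lambda>y. \<delta> * g y)" for y \<delta>
    unfolding g_def
    by (intro bounded_borel_on_ball_integrable bounded_borel_on_ball_continuous continuous_intros)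
  have g_mean: "2 * g y \<le> \<beta> * ball_average \<epsilon> g y" for y
  proof -
    have "g = (\<lambda>y'. g y * exp (a \<bullet> (y' - y)))"
      unfolding g_def by (auto simp: inner_diff_right simp flip: exp_add)
    then have "ball_average \<epsilon> g y = g y * ball_average \<epsilon> (\<lambda>y'. exp (a \<bullet> (y' - y))) y"
      by (metis ball_average_mult)
    also have "\<dots> \<ge> g y * (1 + k * (norm a * \<epsilon>)\<^sup>2)"
      using ball_average_exp_ge[OF \<epsilon>] unfolding g_def k_def by (intro mult_left_mono) auto
    finally have "\<beta> * (g y * (1 + k * (norm a * \<epsilon>)\<^sup>2)) \<le> \<beta> * ball_average \<epsilon> g y"
      using \<alpha>\<beta>(2) by (intro mult_left_mono) auto
    moreover have "\<beta> * (g y * (1 + k * (norm a * \<epsilon>)\<^sup>2)) = g y * (\<beta> + 2)"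
      using ka by (metis mult.left_commute)
    moreover have "g y * 2 \<le> g y * (\<beta> + 2)"
      using \<alpha>\<beta>(2) unfolding g_def by (intro mult_left_mono) auto
    ultimately show ?thesis by linarith
  qed
  have \<Omega>X: "\<Omega> \<subseteq> X" using X \<epsilon> by (meson centre_in_ball subset_iff)
  have main: "f x + \<delta> * g x \<le> \<delta> * exp T" if \<delta>: "0 < \<delta>" for \<delta>
  proof (rule ccontr)
    assume neg: "\<not> ?thesis"
    have xD: "x \<in> D" using x unfolding D_def by simp
    define S where "S = (SUP y\<in>D. f y + \<delta> * g y)"
    have bdd: "bdd_above ((\<lambda>y. f y + \<delta> * g y) ` D)"
    proof -
      obtain B where B: "\<And>y. y \<in> X \<Longrightarrow> \<bar>u y\<bar> \<le> B"
        using u unfolding bounded_borel_on_def bounded_iff by auto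
      show ?thesis
      proof (rule bdd_aboveI2)
        fix y assume "y \<in> D"
        then have y: "y \<in> \<Omega>" "y + h \<in> \<Omega>" unfolding D_def by auto
        have "\<delta> * g y \<le> \<delta> * exp T" using g_le[of y y] y \<epsilon> \<delta> by simp
        then show "f y + \<delta> * g y \<le> 2 * B - \<eta> + \<delta> * exp T"
          using B[of y] B[of "y + h"] subsetD[OF \<Omega>X y(1)] subsetD[OF \<Omega>X y(2)] unfolding f_def by linarith
      qed
    qed
    have S_upper: "f y + \<delta> * g y \<le> S" if "y \<in> D" for y unfolding S_def by (rule cSUP_upper[OF that bdd])
    have S_gt: "\<delta> * exp T < S" using S_upper[OF xD] neg by linarith
    \<comment> \<open>Where f > 0, the perturbed function stays below its supremum S by a fixed amount, because the
      average of g gains more than g itself.\<close>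
    have step: "f y + \<delta> * g y \<le> max (\<delta> * exp T) (S - \<delta> * exp (- T))" if "y \<in> D" for y
    proof (cases "f y \<le> 0")
      case True
      have "\<delta> * g y \<le> \<delta> * exp T" using g_le[of y y] that \<epsilon> \<delta> unfolding D_def by simp
      then show ?thesis using True by linarith
    next
      case False
      have y: "y \<in> \<Omega>" "y + h \<in> \<Omega>" using that unfolding D_def by auto
      \<comment> \<open>If the obstacle were active at y, the obstacle at y + h would force f y to be nonpositive.\<close>
      have "u y = game_mean \<alpha> \<beta> \<epsilon> u y"
        using dpp[OF y(1)] dpp[OF y(2)] \<Psi>[of y] False unfolding f_def by linarith
      moreover have "game_mean \<alpha> \<beta> \<epsilon> u (y + h) \<le> u (y + h)" using dpp[OF y(2)] by linarith
      moreover have "game_mean \<alpha> \<beta> \<epsilon> u y + \<beta> * ball_average \<epsilon> (\<lambda>y. \<delta> * g y) y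
          \<le> game_mean \<alpha> \<beta> \<epsilon> u (y + h) + (S + \<eta>)"
      proof (rule game_mean_translate_le)
        fix y' assume y': "y' \<in> ball y \<epsilon>"
        have yX: "y' \<in> X" "y' + h \<in> X"
          using y' X[OF y(1)] X[OF y(2)] by (auto simp: subset_iff dist_norm)
        have "\<delta> * g y' \<le> \<delta> * exp T" using g_le[OF y(1)] y' \<delta> by simp
        then show "u y' + \<delta> * g y' \<le> u (y' + h) + (S + \<eta>)"
          using S_upper[of y'] S_gt outside[OF yX] unfolding D_def f_def by fastforce
      qed (use \<alpha>\<beta> \<epsilon> g_int \<delta> bounded_borel_on_subset[OF u X] y in \<open>auto simp: g_def\<close>)
      moreover have "\<delta> * (2 * g y) \<le> \<beta> * ball_average \<epsilon> (\<lambda>y. \<delta> * g y) y"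
        using mult_left_mono[OF g_mean[of y], of \<delta>] \<delta>
        by (simp only: ball_average_mult mult.left_commute[of \<beta>])
      moreover have "\<delta> * exp (- T) \<le> \<delta> * g y" using g_ge[OF y(1)] \<delta> by simp
      ultimately have "f y + \<delta> * g y \<le> S - \<delta> * exp (- T)" unfolding f_def by linarith
      then show ?thesis by simp
    qed
    have "S \<le> max (\<delta> * exp T) (S - \<delta> * exp (- T))"
      unfolding S_def by (intro cSUP_least) (use xD step in \<open>auto simp: S_def\<close>)
    moreover have "0 < \<delta> * exp (- T)" using \<delta> by simp
    ultimately show False using S_gt by linarith
  qed
  have "f x \<le> 0"
  proof (rule field_le_epsilon)
    fix \<delta> :: real assume "0 < \<delta>"
    then have \<delta>: "0 < \<delta> / exp T" by simp
    have "0 < \<delta> / exp T * g x" unfolding g_def by (rule mult_pos_pos[OF \<delta> exp_gt_zero])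
    then show "f x \<le> 0 + \<delta>" using main[OF \<delta>] by simp
  qed
  then show ?thesis unfolding f_def by simp
qed

section \<open>Equicontinuity up to the boundary\<close>

lemma segment_crosses_frontier:
  fixes x y :: "'a::euclidean_space"
  assumes "x \<notin> S" "y \<in> S"
  obtains z where "z \<in> frontier S" "dist z x \<le> dist x y" "dist z y \<le> dist x y"
proof -
  have "closed_segment x y \<inter> frontier S \<noteq> {}"
    using assms by (intro connected_Int_frontier) auto
  then obtain z where "z \<in> closed_segment x y" "z \<in> frontier S" by auto
  then show ?thesis
    using that segment_bound[of z x y] by (auto simp: dist_norm norm_minus_commute)
qed

theorem corollary4p6:
  fixes \<Omega> :: "'a::euclidean_space set"
    and \<epsilon>\<^sub>0 p \<alpha> \<beta> :: real
    and F \<Psi> :: "'a \<Rightarrow> real"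
    and u :: "real \<Rightarrow> 'a \<Rightarrow> real"
  assumes "open \<Omega>" and "bounded \<Omega>" and "lipschitz_boundary \<Omega>"
    and "0 < \<epsilon>\<^sub>0" and "\<epsilon>\<^sub>0 < 1"
    and "\<exists>L. L-lipschitz_on (closure (outer_collar \<epsilon>\<^sub>0 \<Omega>)) F"
    and "\<exists>L. L-lipschitz_on UNIV \<Psi>" and "bounded (range \<Psi>)"
    and "\<forall>x \<in> closure (outer_collar \<epsilon>\<^sub>0 \<Omega>). \<Psi> x \<le> F x"
    and "2 \<le> p"
    and "\<alpha> = (p - 2) / (p + real DIM('a))"
    and "\<beta> = (2 + real DIM('a)) / (p + real DIM('a))"
    and "\<forall>\<epsilon> \<in> {0<..\<epsilon>\<^sub>0}. obstacle_dpp_solution \<alpha> \<beta> \<epsilon>\<^sub>0 \<Omega> F \<Psi> \<epsilon> (u \<epsilon>)"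
  shows "\<forall>\<eta> > 0. \<exists>r\<^sub>0 > 0. \<exists>\<epsilon>\<^sub>1 \<in> {0<..\<epsilon>\<^sub>0}. \<forall>\<epsilon> \<in> {0<..<\<epsilon>\<^sub>1}.
           \<forall>x\<^sub>0 \<in> closure \<Omega>. \<forall>y\<^sub>0 \<in> closure \<Omega>.
             dist x\<^sub>0 y\<^sub>0 < r\<^sub>0 \<longrightarrow> \<bar>u \<epsilon> x\<^sub>0 - u \<epsilon> y\<^sub>0\<bar> < \<eta>"
proof (cases "\<Omega> = {}")
  case True
  then show ?thesis using \<open>0 < \<epsilon>\<^sub>0\<close> by (intro allI impI exI[of _ 1] conjI bexI[of _ \<epsilon>\<^sub>0]) auto
next
  case ne: False
  define \<Gamma> where "\<Gamma> = outer_collar \<epsilon>\<^sub>0 \<Omega>"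
  define X where "X = \<Omega> \<union> \<Gamma>"
  have N: "0 < p + real DIM('a)" using \<open>2 \<le> p\<close> by linarith
  have \<alpha>\<beta>: "0 \<le> \<alpha>" "0 < \<beta>" "0 \<le> \<beta>" "\<alpha> + \<beta> = 1"
    unfolding \<open>\<alpha> = _\<close> \<open>\<beta> = _\<close> using N \<open>2 \<le> p\<close> by (auto simp flip: add_divide_distrib)
  have X_ball: "ball x \<epsilon> \<subseteq> X" if "x \<in> \<Omega>" "\<epsilon> \<le> \<epsilon>\<^sub>0" for x \<epsilon>
  proof
    fix y assume "y \<in> ball x \<epsilon>"
    then have "infdist y \<Omega> < \<epsilon>\<^sub>0" using infdist_le[OF that(1), of y] that(2) by (simp add: dist_commute)
    then show "y \<in> X" unfolding X_def \<Gamma>_def outer_collar_def by auto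
  qed
  have frontier_\<Gamma>: "frontier \<Omega> \<subseteq> \<Gamma>"
    using \<open>open \<Omega>\<close> \<open>0 < \<epsilon>\<^sub>0\<close> in_closure_iff_infdist_zero[OF ne]
    unfolding frontier_def \<Gamma>_def outer_collar_def by (auto simp: interior_open)
  then have closure_X: "closure \<Omega> \<subseteq> X"
    unfolding X_def closure_Un_frontier by auto
  have "bounded \<Gamma>"
  proof -
    obtain R where R: "\<And>y. y \<in> \<Omega> \<Longrightarrow> norm y \<le> R" using \<open>bounded \<Omega>\<close> by (auto simp: bounded_iff)
    have "norm x \<le> R + \<epsilon>\<^sub>0" if "x \<in> \<Gamma>" for x
    proof -
      have "infdist x \<Omega> < \<epsilon>\<^sub>0" using that unfolding \<Gamma>_def outer_collar_def by simp
      then obtain y where "y \<in> \<Omega>" "dist x y < \<epsilon>\<^sub>0" 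
        using ne by (auto simp: infdist_def cINF_less_iff)
      then show ?thesis using R[of y] norm_triangle_sub[of x y] by (simp add: dist_norm)
    qed
    then show ?thesis by (auto simp: bounded_iff)
  qed
  obtain LF L\<Psi> where LF: "LF-lipschitz_on (closure \<Gamma>) F" and L\<Psi>: "L\<Psi>-lipschitz_on UNIV \<Psi>"
    using assms(6,7) unfolding \<Gamma>_def by auto
  define L where "L = LF + L\<Psi> + 1"
  have L0: "0 \<le> LF" "0 \<le> L\<Psi>" using lipschitz_on_nonneg LF L\<Psi> by blast+
  then have L: "0 < L" unfolding L_def by simp
  have F_lip: "\<bar>F x - F y\<bar> \<le> L * d" if "x \<in> \<Gamma>" "y \<in> \<Gamma>" "dist x y \<le> d" for x y d
  proof -
    have "\<bar>F x - F y\<bar> \<le> LF * dist x y"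
      using lipschitz_onD[OF LF, of x y] that closure_subset by (auto simp: dist_real_def)
    also have "\<dots> \<le> L * d" using L0 that(3) unfolding L_def by (intro mult_mono) auto
    finally show ?thesis .
  qed
  have \<Psi>_lip: "\<bar>\<Psi> x - \<Psi> y\<bar> \<le> L * d" if "dist x y \<le> d" for x y d
  proof -
    have "\<bar>\<Psi> x - \<Psi> y\<bar> \<le> L\<Psi> * dist x y" using lipschitz_onD[OF L\<Psi>, of x y] by (simp add: dist_real_def)
    also have "\<dots> \<le> L * d" using L0 that unfolding L_def by (intro mult_mono) auto
    finally show ?thesis .
  qed
  have \<Psi>F: "\<Psi> x \<le> F x" if "x \<in> \<Gamma>" for x using assms(9) that closure_subset unfolding \<Gamma>_def by blast
  obtain C\<^sub>0 where C0: "\<And>x. x \<in> \<Gamma> \<Longrightarrow> \<bar>F x\<bar> \<le> C\<^sub>0" "\<And>x. \<bar>\<Psi> x\<bar> \<le> C\<^sub>0"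
  proof -
    have "compact (F ` closure \<Gamma>)"
      using \<open>bounded \<Gamma>\<close> LF by (intro compact_continuous_image lipschitz_on_continuous_on) (auto simp: compact_closure)
    then obtain B where B: "\<And>x. x \<in> closure \<Gamma> \<Longrightarrow> \<bar>F x\<bar> \<le> B"
      using compact_imp_bounded[of "F ` closure \<Gamma>"] by (auto simp: bounded_iff)
    obtain B' where B': "\<And>x. \<bar>\<Psi> x\<bar> \<le> B'"
      using \<open>bounded (range \<Psi>)\<close> by (auto simp: bounded_iff)
    show ?thesis
    proof (rule that[of "max B B'"])
      show "\<bar>F x\<bar> \<le> max B B'" if "x \<in> \<Gamma>" for x using B[of x] that closure_subset[of \<Gamma>] by auto
      show "\<bar>\<Psi> x\<bar> \<le> max B B'" for x using B'[of x] by linarith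
    qed
  qed
  have u_F: "u \<epsilon> x = F x" if "0 < \<epsilon>" "\<epsilon> \<le> \<epsilon>\<^sub>0" "x \<in> \<Gamma>" for \<epsilon> x
    using assms(13) that unfolding obstacle_dpp_solution_def \<Gamma>_def by auto
  have u_dpp: "u \<epsilon> x = max (\<Psi> x) (game_mean \<alpha> \<beta> \<epsilon> (u \<epsilon>) x)" if "0 < \<epsilon>" "\<epsilon> \<le> \<epsilon>\<^sub>0" "x \<in> \<Omega>" for \<epsilon> x
    using assms(13) that unfolding obstacle_dpp_solution_def game_mean_def by auto
  have u_bb: "bounded_borel_on X (u \<epsilon>)" if "0 < \<epsilon>" "\<epsilon> \<le> \<epsilon>\<^sub>0" for \<epsilon>
    using assms(13) that unfolding obstacle_dpp_solution_def bounded_borel_on_def X_def \<Gamma>_def by auto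
  \<comment> \<open>The obstacle pushes solutions up only, so their negatives are subsolutions without any obstacle.\<close>
  have neg_sub: "- u \<epsilon> x \<le> game_mean \<alpha> \<beta> \<epsilon> (\<lambda>y. - u \<epsilon> y) x" if "0 < \<epsilon>" "\<epsilon> \<le> \<epsilon>\<^sub>0" "x \<in> \<Omega>" for \<epsilon> x
    using u_dpp[OF that] game_mean_uminus[OF that(1) bounded_borel_on_subset[OF u_bb[OF that(1,2)] X_ball[OF that(3,2)]]]
    by simp
  define C where "C = C\<^sub>0 + 1"
  define \<epsilon>\<^sub>2 where "\<epsilon>\<^sub>2 = min \<epsilon>\<^sub>0 (moment_const TYPE('a))"
  have \<epsilon>2: "0 < \<epsilon>\<^sub>2" using \<open>0 < \<epsilon>\<^sub>0\<close> moment_const_bounds(1)[where 'a='a] unfolding \<epsilon>\<^sub>2_def by simp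
  have u_C: "u \<epsilon> x \<le> C" "- u \<epsilon> x \<le> C" if "0 < \<epsilon>" "\<epsilon> \<le> \<epsilon>\<^sub>2" "x \<in> \<Omega>" for \<epsilon> x
  proof -
    have \<epsilon>: "\<epsilon> \<le> \<epsilon>\<^sub>0" "\<epsilon> \<le> moment_const TYPE('a)" using that unfolding \<epsilon>\<^sub>2_def by auto
    have out: "\<bar>u \<epsilon> y\<bar> \<le> C\<^sub>0" if "y \<in> X - \<Omega>" for y
      using u_F[OF \<open>0 < \<epsilon>\<close> \<epsilon>(1)] C0(1) that unfolding X_def by auto
    show "u \<epsilon> x \<le> C"
      unfolding C_def
    proof (rule subsolution_bounded_above[OF \<alpha>\<beta>(1,3,4) \<open>bounded \<Omega>\<close> that(1) \<epsilon>(2) u_bb[OF that(1) \<epsilon>(1)]])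
      show "u \<epsilon> y \<le> C\<^sub>0" if "y \<in> X - \<Omega>" for y using out[OF that] by linarith
      show "u \<epsilon> y \<le> C\<^sub>0 \<or> u \<epsilon> y \<le> game_mean \<alpha> \<beta> \<epsilon> (u \<epsilon>) y" if "y \<in> \<Omega>" for y
        using u_dpp[OF \<open>0 < \<epsilon>\<close> \<epsilon>(1) that] C0(2)[of y] by linarith
    qed (use that X_ball \<epsilon> in auto)
    show "- u \<epsilon> x \<le> C"
      unfolding C_def
    proof (rule subsolution_bounded_above[OF \<alpha>\<beta>(1,3,4) \<open>bounded \<Omega>\<close> that(1) \<epsilon>(2)
          bounded_borel_on_uminus[OF u_bb[OF that(1) \<epsilon>(1)]]])
      show "- u \<epsilon> y \<le> C\<^sub>0" if "y \<in> X - \<Omega>" for y using out[OF that] by linarith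
    qed (use that X_ball \<epsilon> neg_sub in auto)
  qed
  obtain \<mu> t\<^sub>0 where cork: "0 < \<mu>" "\<mu> \<le> 1" "0 < t\<^sub>0" "exterior_corkscrew \<mu> t\<^sub>0 \<Omega>"
    using lipschitz_boundary_corkscrew[OF assms(1-3)] by blast
  show ?thesis
  proof (intro allI impI)
    fix \<eta> :: real assume \<eta>: "0 < \<eta>"
    define R where "R = \<eta> / (8 * L)"
    have R: "0 < R" "L * R = \<eta> / 8" unfolding R_def using \<eta> L by auto
    have \<eta>8: "0 < \<eta> / 8" using \<eta> by simp
    obtain r \<epsilon>\<^sub>3 where r: "0 < r" "0 < \<epsilon>\<^sub>3" and modulus:
      "\<And>\<epsilon> X z m w x. \<lbrakk>0 < \<epsilon>; \<epsilon> < \<epsilon>\<^sub>3; z \<in> frontier \<Omega>; bounded_borel_on X w;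
         \<And>x. x \<in> \<Omega> \<Longrightarrow> ball x \<epsilon> \<subseteq> X; \<And>x. x \<in> \<Omega> \<Longrightarrow> w x \<le> C; - C \<le> m;
         \<And>x. x \<in> X - \<Omega> \<Longrightarrow> dist z x < R \<Longrightarrow> w x \<le> m;
         \<And>x. x \<in> \<Omega> \<Longrightarrow> dist z x < R \<Longrightarrow> w x \<le> m \<or> w x \<le> game_mean \<alpha> \<beta> \<epsilon> w x;
         x \<in> \<Omega>; dist z x < r\<rbrakk> \<Longrightarrow> w x \<le> m + \<eta> / 8"
      by (fact boundary_modulus[OF \<alpha>\<beta>(1,3,4) cork R(1) \<eta>8])
    define \<epsilon>\<^sub>1 where "\<epsilon>\<^sub>1 = min \<epsilon>\<^sub>2 \<epsilon>\<^sub>3"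
    define r\<^sub>0 where "r\<^sub>0 = min r R"
    have r0: "0 < r\<^sub>0" unfolding r\<^sub>0_def using r R by simp
    have \<epsilon>1: "\<epsilon>\<^sub>1 \<in> {0<..\<epsilon>\<^sub>0}" unfolding \<epsilon>\<^sub>1_def using r \<epsilon>2 unfolding \<epsilon>\<^sub>2_def by auto
    have "\<bar>u \<epsilon> x - u \<epsilon> y\<bar> < \<eta>" if \<epsilon>: "0 < \<epsilon>" "\<epsilon> < \<epsilon>\<^sub>1" and xy: "x \<in> X" "y \<in> X" "dist x y < r\<^sub>0" for \<epsilon> x y
    proof -
      have \<epsilon>': "\<epsilon> \<le> \<epsilon>\<^sub>0" "\<epsilon> \<le> \<epsilon>\<^sub>2" "\<epsilon> < \<epsilon>\<^sub>3" using \<epsilon> unfolding \<epsilon>\<^sub>1_def \<epsilon>\<^sub>2_def by auto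
      \<comment> \<open>The level F z + \<eta> / 8 dominates both the boundary values and the obstacle on the ball of radius R
        around z; for the negative of u only the boundary values count.\<close>
      have boundary: "\<bar>u \<epsilon> y - F z\<bar> \<le> \<eta> / 4" if z: "z \<in> frontier \<Omega>" and y: "y \<in> \<Omega>" "dist z y < r" for z y
      proof -
        have z\<Gamma>: "z \<in> \<Gamma>" using z frontier_\<Gamma> by auto
        have F_near: "\<bar>u \<epsilon> y - F z\<bar> \<le> \<eta> / 8" if "y \<in> X - \<Omega>" "dist z y < R" for y
        proof -
          have "y \<in> \<Gamma>" using that unfolding X_def by auto
          then show ?thesis
            using F_lip[of y z R] z\<Gamma> that(2) R(2) u_F[OF \<epsilon>(1) \<epsilon>'(1)] by (simp add: dist_commute)
        qed
        have \<Psi>_near: "\<Psi> y \<le> F z + \<eta> / 8" if "dist z y < R" for y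
          using \<Psi>_lip[of z y R] \<Psi>F[OF z\<Gamma>] that R(2) by auto
        have "u \<epsilon> y \<le> (F z + \<eta> / 8) + \<eta> / 8"
        proof (rule modulus[OF \<epsilon>(1) \<epsilon>'(3) z u_bb[OF \<epsilon>(1) \<epsilon>'(1)]])
          show "- C \<le> F z + \<eta> / 8" using C0(1)[OF z\<Gamma>] \<eta> unfolding C_def by linarith
          show "u \<epsilon> y \<le> F z + \<eta> / 8" if "y \<in> X - \<Omega>" "dist z y < R" for y
            using F_near[OF that] by linarith
          show "u \<epsilon> y \<le> F z + \<eta> / 8 \<or> u \<epsilon> y \<le> game_mean \<alpha> \<beta> \<epsilon> (u \<epsilon>) y" if "y \<in> \<Omega>" "dist z y < R" for y
            using u_dpp[OF \<epsilon>(1) \<epsilon>'(1) that(1)] \<Psi>_near[OF that(2)] by linarith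
        qed (use X_ball \<epsilon>' u_C[OF \<epsilon>(1) \<epsilon>'(2)] y in auto)
        moreover have "- u \<epsilon> y \<le> (- F z + \<eta> / 8) + \<eta> / 8"
        proof (rule modulus[OF \<epsilon>(1) \<epsilon>'(3) z bounded_borel_on_uminus[OF u_bb[OF \<epsilon>(1) \<epsilon>'(1)]]])
          show "- C \<le> - F z + \<eta> / 8" using C0(1)[OF z\<Gamma>] \<eta> unfolding C_def by linarith
          show "- u \<epsilon> y \<le> - F z + \<eta> / 8" if "y \<in> X - \<Omega>" "dist z y < R" for y
            using F_near[OF that] by linarith
        qed (use X_ball \<epsilon>' u_C[OF \<epsilon>(1) \<epsilon>'(2)] neg_sub[OF \<epsilon>(1) \<epsilon>'(1)] y in auto)
        ultimately show ?thesis by linarith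
      qed
      have near_\<Gamma>: "\<bar>u \<epsilon> x - u \<epsilon> y\<bar> \<le> \<eta> / 2" if x: "x \<in> \<Gamma>" and y: "y \<in> X" and d: "dist x y < r\<^sub>0" for x y
      proof (cases "y \<in> \<Omega>")
        case False
        then have "y \<in> \<Gamma>" using y unfolding X_def by simp
        then have "\<bar>F x - F y\<bar> \<le> \<eta> / 8" using F_lip[of x y R] x d R(2) unfolding r\<^sub>0_def by simp
        then show ?thesis using u_F[OF \<epsilon>(1) \<epsilon>'(1)] x \<open>y \<in> \<Gamma>\<close> \<eta> by simp
      next
        case True
        have "x \<notin> \<Omega>" using x unfolding \<Gamma>_def outer_collar_def by simp
        then obtain z where z: "z \<in> frontier \<Omega>" "dist z x \<le> dist x y" "dist z y \<le> dist x y"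
          using segment_crosses_frontier True by blast
        have "\<bar>F z - F x\<bar> \<le> \<eta> / 8"
          using F_lip[of z x R] z x d R(2) frontier_\<Gamma> unfolding r\<^sub>0_def by auto
        moreover have "\<bar>u \<epsilon> y - F z\<bar> \<le> \<eta> / 4" using boundary[OF z(1) True] z(3) d unfolding r\<^sub>0_def by simp
        ultimately show ?thesis using u_F[OF \<epsilon>(1) \<epsilon>'(1) x] \<eta> by linarith
      qed
      have near: "\<bar>u \<epsilon> x - u \<epsilon> y\<bar> \<le> \<eta> / 2"
        if "x \<in> X" "y \<in> X" "x \<notin> \<Omega> \<or> y \<notin> \<Omega>" "dist x y < r\<^sub>0" for x y
        using that near_\<Gamma>[of x y] near_\<Gamma>[of y x] unfolding X_def by (auto simp: dist_commute abs_minus_commute)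
      \<comment> \<open>Along the translation by h = y - x, the values at two points that do not both lie in \<Omega>
        differ by at most \<eta> / 2, and comparison carries this bound to the interior.\<close>
      have interior: "u \<epsilon> x \<le> u \<epsilon> y + \<eta> / 2" if x: "x \<in> \<Omega>" "y \<in> \<Omega>" and d: "dist x y < r\<^sub>0" for x y
      proof -
        define h where "h = y - x"
        have h: "norm h < r\<^sub>0" using d unfolding h_def by (simp add: dist_norm norm_minus_commute)
        have "u \<epsilon> x \<le> u \<epsilon> (x + h) + \<eta> / 2"
        proof (rule translation_comparison[OF \<alpha>\<beta>(1,2,4) \<epsilon>(1) \<open>bounded \<Omega>\<close> u_bb[OF \<epsilon>(1) \<epsilon>'(1)] X_ball[OF _ \<epsilon>'(1)]
              u_dpp[OF \<epsilon>(1) \<epsilon>'(1)]])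
          show "\<Psi> x \<le> \<Psi> (x + h) + \<eta> / 2" for x
            using \<Psi>_lip[of x "x + h" R] h R(2) \<eta> unfolding r\<^sub>0_def by (auto simp: dist_norm)
          show "u \<epsilon> y \<le> u \<epsilon> (y + h) + \<eta> / 2"
            if "y \<in> X" "y + h \<in> X" "y \<notin> \<Omega> \<or> y + h \<notin> \<Omega>" for y
          proof -
            have "dist y (y + h) < r\<^sub>0" using h by (simp add: dist_norm)
            then show ?thesis using near[OF that] by linarith
          qed
        qed (use x in \<open>auto simp: h_def\<close>)
        then show ?thesis unfolding h_def by simp
      qed
      show ?thesis
      proof (cases "x \<in> \<Omega> \<and> y \<in> \<Omega>")
        case True
        then show ?thesis using interior[of x y] interior[of y x] xy(3) \<eta> by (simp add: dist_commute)
      next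
        case False
        then show ?thesis using near[OF xy(1,2) _ xy(3)] \<eta> by auto
      qed
    qed
    then show "\<exists>r\<^sub>0 > 0. \<exists>\<epsilon>\<^sub>1 \<in> {0<..\<epsilon>\<^sub>0}. \<forall>\<epsilon> \<in> {0<..<\<epsilon>\<^sub>1}. \<forall>x\<^sub>0 \<in> closure \<Omega>. \<forall>y\<^sub>0 \<in> closure \<Omega>.
        dist x\<^sub>0 y\<^sub>0 < r\<^sub>0 \<longrightarrow> \<bar>u \<epsilon> x\<^sub>0 - u \<epsilon> y\<^sub>0\<bar> < \<eta>"
      using r0 \<epsilon>1 closure_X by (intro exI[of _ r\<^sub>0] conjI bexI[of _ \<epsilon>\<^sub>1]) (auto simp: subset_iff)
  qed
qed

end
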